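(* Let $X$ be a compact, connected, locally connected, metrizable topological space, and let $f: X \to X$ be a topological coarse expanding conformal (topological cxc) dynamical system. If $X$ contains a homeomorphic copy of $\mathbb{Y}$, then for every metric $d$ in the canonical gauge $\mathcal{G}(f)$ the Hausdorff dimension of $(X,d)$ is strictly greater than $1$.
   Context: $\mathbb{Y}=[0,e_1]\cup[0,e_2]\cup[0,e_3]\subset\mathbb{R}^3$, where $e_1,e_2,e_3$ is the standard basis: three unit segments meeting at the origin. $\mathbb{N}=\{0,1,2,\dots\}$. Finite branched coverings. For compact Hausdorff connected locally connected spaces $X,Z$ and a finite-to-one continuous map $f:X\to Z$, put $\deg(f)=\sup\{\#f^{-1}(z): z\in Z\}$ (the same definition is used for restrictions $f:\widetilde U\to U$) and $\deg(f;x)=\inf_U\sup\{\#(f^{-1}(z)\cap U): z\in f(U)\}$, the infimum over all neighborhoods $U$ of $x$. $f$ is a finite branched covering (fbc) if $\deg(f)<\infty$ and (i) $\sum_{x\in f^{-1}(z)}\deg(f;x)=\deg(f)$ for every $z\in Z$; (ii) for every $x_0\in X$ there are compact neighborhoods $U$ of $x_0$ and $V$ of $f(x_0)$ with $\sum_{x\in U, f(x)=z}\deg(f;x)=\deg(f;x_0)$ for all $z\in V$. Topological cxc. Let $X$ be a non-singleton compact, connected, locally connected, metrizable space and $f:X\to X$ an fbc. Let $\mathcal{U}_0$ be a finite cover of $X$ by nonempty open connected sets; for $n\ge1$ let $\mathcal{U}_n$ be the collection of connected components of the sets $f^{-1}(U)$, $U\in\mathcal{U}_{n-1}$. $f$ is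 topological cxc with respect to $\mathcal{U}_0$ if: (Expansion) for every open cover $\mathcal{V}$ of $X$ there is $N$ such that for every $n>N$ each $U\in\mathcal{U}_n$ is contained in some $V\in\mathcal{V}$; (Degree) $\max\{\deg(f^k:\widetilde U\to U): k\in\mathbb{N},\ \widetilde U\in\mathcal{U}_k,\ U=f^k(\widetilde U)\in\mathcal{U}_0\}<\infty$; (Irreducibility) for every nonempty open $W\subset X$ there is $n\in\mathbb{N}$ with $f^n(W)=X$. $f$ is topological cxc if this holds for some such $\mathcal{U}_0$. Metric cxc. Let $d$ be a metric inducing the topology of $X$. For $a$ in the interior of $A$ let $\mathrm{round}(A,a)=\sup\{d(x,a):x\in A\}/\sup\{r: B(a,r)\subset A\}$. $f$ is metric cxc with respect to $d$ if for some $\mathcal{U}_0$ it is topological cxc with respect to $\mathcal{U}_0$ and there exist continuous increasing embeddings $\rho_\pm:[1,\infty)\to[1,\infty)$ and increasing homeomorphisms $\delta_\pm:[0,\infty)\to[0,\infty)$ such that: (Roundness distortion) for all $n,k\in\mathbb{N}$, $U\in\mathcal{U}_n$, $\widetilde U\in\mathcal{U}_{n+k}$, $\tilde y\in\widetilde U$, $y\in U$ with $f^k(\widetilde U)=U$, $f^k(\tilde y)=y$: $\mathrm{round}(\widetilde U,\tilde y)<\rho_-(\mathrm{round}(U,y))$ and $\mathrm{round}(U,y)<\rho_+(\mathrm{round}(\widetilde U,\tilde y))$; (Diameter distortion) for all $n_0,n_1,k\in\mathbb{N}$, $U\in\mathcal{U}_{n_0}$, $U'\in\mathcal{U}_{n_1}$,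 $\widetilde U\in\mathcal{U}_{n_0+k}$, $\widetilde U'\in\mathcal{U}_{n_1+k}$ with $U'\subset U$, $\widetilde U'\subset\widetilde U$, $f^k(\widetilde U)=U$, $f^k(\widetilde U')=U'$: $\frac{\operatorname{diam}\widetilde U'}{\operatorname{diam}\widetilde U}<\delta_-\!\left(\frac{\operatorname{diam}U'}{\operatorname{diam}U}\right)$ and $\frac{\operatorname{diam}U'}{\operatorname{diam}U}<\delta_+\!\left(\frac{\operatorname{diam}\widetilde U'}{\operatorname{diam}\widetilde U}\right)$. Canonical gauge. $\mathcal{G}(f)$ is the set of all metrics $d$ on $X$ (inducing its topology) with respect to which $f$ is metric cxc. (It is a known fact that for topological cxc $f$ this set is nonempty and is a single quasi-symmetric equivalence class of metrics.) *)

theory Defs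
  imports "HOL-Analysis.Analysis"
begin

definition tripod :: "(real^3) set" where
  "tripod = closed_segment 0 (axis 1 1) \<union> closed_segment 0 (axis 2 1) \<union> closed_segment 0 (axis 3 1)"

section \<open>Finite branched coverings\<close>

text \<open>Spaces are abstract topologies; a map is a HOL function of which only the values on the
  carrier matter.  Degrees are extended naturals.  The cardinality below is meant for finite
  fibres only (\<open>card\<close> is 0 on infinite sets); every use is accompanied by a
  finite-to-one hypothesis.\<close>

definition map_degree :: "('a \<Rightarrow> 'b) \<Rightarrow> 'a set \<Rightarrow> 'b set \<Rightarrow> enat" where
  "map_degree f S T = (SUP z\<in>T. enat (card {x \<in> S. f x = z}))"

definition neighbourhood_of :: "'a topology \<Rightarrow> 'a set \<Rightarrow> 'a \<Rightarrow> bool" where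
  "neighbourhood_of X U x \<longleftrightarrow> U \<subseteq> topspace X \<and> x \<in> X interior_of U"

definition local_degree :: "'a topology \<Rightarrow> ('a \<Rightarrow> 'b) \<Rightarrow> 'a \<Rightarrow> enat" where
  "local_degree X f x = (INF U\<in>{U. neighbourhood_of X U x}. map_degree f U (f ` U))"

definition finite_branched_covering :: "'a topology \<Rightarrow> 'b topology \<Rightarrow> ('a \<Rightarrow> 'b) \<Rightarrow> bool" where
  "finite_branched_covering X Z f \<longleftrightarrow>
     compact_space X \<and> Hausdorff_space X \<and> connected_space X \<and> locally_connected_space X \<and>
     compact_space Z \<and> Hausdorff_space Z \<and> connected_space Z \<and> locally_connected_space Z \<and>
     continuous_map X Z f \<and>
     (\<forall>z\<in>topspace Z. finite {x \<in> topspace X. f x = z}) \<and>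
     map_degree f (topspace X) (topspace Z) < \<infinity> \<and>
     (\<forall>z\<in>topspace Z. (\<Sum>x\<in>{x \<in> topspace X. f x = z}. local_degree X f x)
                       = map_degree f (topspace X) (topspace Z)) \<and>
     (\<forall>x0\<in>topspace X. \<exists>U V.
        compactin X U \<and> neighbourhood_of X U x0 \<and>
        compactin Z V \<and> neighbourhood_of Z V (f x0) \<and>
        (\<forall>z\<in>V. (\<Sum>x\<in>{x \<in> U. f x = z}. local_degree X f x) = local_degree X f x0))"

section \<open>Coarse expanding conformal systems\<close>

primrec pullback_cover :: "'a topology \<Rightarrow> ('a \<Rightarrow> 'a) \<Rightarrow> 'a set set \<Rightarrow> nat \<Rightarrow> 'a set set" where
  "pullback_cover X f \<U> 0 = \<U>"
| "pullback_cover X f \<U> (Suc n) =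
     (\<Union>U\<in>pullback_cover X f \<U> n.
        connected_components_of (subtopology X {x \<in> topspace X. f x \<in> U}))"

definition expansion_axiom :: "'a topology \<Rightarrow> ('a \<Rightarrow> 'a) \<Rightarrow> 'a set set \<Rightarrow> bool" where
  "expansion_axiom X f \<U> \<longleftrightarrow>
     (\<forall>\<V>. (\<forall>V\<in>\<V>. openin X V) \<and> \<Union>\<V> = topspace X \<longrightarrow>
        (\<exists>N. \<forall>n>N. \<forall>U\<in>pullback_cover X f \<U> n. \<exists>V\<in>\<V>. U \<subseteq> V))"

definition degree_axiom :: "'a topology \<Rightarrow> ('a \<Rightarrow> 'a) \<Rightarrow> 'a set set \<Rightarrow> bool" where
  "degree_axiom X f \<U> \<longleftrightarrow>
     Sup {map_degree (f ^^ k) U' U | k U' U.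
            U' \<in> pullback_cover X f \<U> k \<and> U = (f ^^ k) ` U' \<and> U \<in> \<U>} < \<infinity>"

definition irreducibility_axiom :: "'a topology \<Rightarrow> ('a \<Rightarrow> 'a) \<Rightarrow> bool" where
  "irreducibility_axiom X f \<longleftrightarrow>
     (\<forall>W. openin X W \<and> W \<noteq> {} \<longrightarrow> (\<exists>n. (f ^^ n) ` W = topspace X))"

definition topological_cxc_wrt :: "'a topology \<Rightarrow> ('a \<Rightarrow> 'a) \<Rightarrow> 'a set set \<Rightarrow> bool" where
  "topological_cxc_wrt X f \<U> \<longleftrightarrow>
     (\<exists>x\<in>topspace X. \<exists>y\<in>topspace X. x \<noteq> y) \<and>
     compact_space X \<and> connected_space X \<and> locally_connected_space X \<and> metrizable_space X \<and>
     finite_branched_covering X X f \<and>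
     finite \<U> \<and> (\<forall>U\<in>\<U>. U \<noteq> {} \<and> openin X U \<and> connectedin X U) \<and> \<Union>\<U> = topspace X \<and>
     expansion_axiom X f \<U> \<and> degree_axiom X f \<U> \<and> irreducibility_axiom X f"

definition topological_cxc :: "'a topology \<Rightarrow> ('a \<Rightarrow> 'a) \<Rightarrow> bool" where
  "topological_cxc X f \<longleftrightarrow> (\<exists>\<U>. topological_cxc_wrt X f \<U>)"

section \<open>Metric coarse expanding conformal systems\<close>

text \<open>As for the library constant \<open>diameter\<close>, the value is meaningful only for
  bounded sets.\<close>

definition mdiameter :: "'a metric \<Rightarrow> 'a set \<Rightarrow> real" where
  "mdiameter d S = (if S = {} then 0 else (SUP (x,y)\<in>S \<times> S. mdist d x y))"

text \<open>The real-valued suprema are over bounded nonempty sets if \<open>a\<close> is in the interior of a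
  proper subset \<open>A\<close> of a compact space.  The roundness is used only for members of the pullback
  covers of a topological cxc system.  These are open, and never the whole space:
  \<open>X \<in> \<U>\<^sub>n\<close> would give \<open>X \<in> \<U>\<^sub>0\<close>, hence \<open>X \<in> \<U>\<^sub>m\<close> for all \<open>m\<close>, which
  contradicts expansion as \<open>X\<close> is not a singleton.\<close>

definition roundness :: "'a metric \<Rightarrow> 'a set \<Rightarrow> 'a \<Rightarrow> real" where
  "roundness d A a = (SUP x\<in>A. mdist d x a) / Sup {r. 0 < r \<and> mball_of d a r \<subseteq> A}"

definition roundness_gauge :: "(real \<Rightarrow> real) \<Rightarrow> bool" where
  "roundness_gauge \<rho> \<longleftrightarrow>
     embedding_map (top_of_set {1..}) (top_of_set {1..}) \<rho> \<and> strict_mono_on {1..} \<rho>"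

definition diameter_gauge :: "(real \<Rightarrow> real) \<Rightarrow> bool" where
  "diameter_gauge \<delta> \<longleftrightarrow>
     homeomorphic_map (top_of_set {0..}) (top_of_set {0..}) \<delta> \<and> strict_mono_on {0..} \<delta>"

definition roundness_distortion ::
  "'a topology \<Rightarrow> ('a \<Rightarrow> 'a) \<Rightarrow> 'a set set \<Rightarrow> 'a metric \<Rightarrow> (real \<Rightarrow> real) \<Rightarrow> (real \<Rightarrow> real) \<Rightarrow> bool" where
  "roundness_distortion X f \<U> d \<rho>m \<rho>p \<longleftrightarrow>
     (\<forall>n k. \<forall>U\<in>pullback_cover X f \<U> n. \<forall>U'\<in>pullback_cover X f \<U> (n + k).
        \<forall>y'\<in>U'. \<forall>y\<in>U. (f ^^ k) ` U' = U \<and> (f ^^ k) y' = y \<longrightarrow>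
          roundness d U' y' < \<rho>m (roundness d U y) \<and>
          roundness d U y < \<rho>p (roundness d U' y'))"

text \<open>\<open>U1 \<subseteq> U0\<close> are the sets downstairs, \<open>W1 \<subseteq> W0\<close> their lifts under the \<open>k\<close>-th iterate.\<close>

definition diameter_distortion ::
  "'a topology \<Rightarrow> ('a \<Rightarrow> 'a) \<Rightarrow> 'a set set \<Rightarrow> 'a metric \<Rightarrow> (real \<Rightarrow> real) \<Rightarrow> (real \<Rightarrow> real) \<Rightarrow> bool" where
  "diameter_distortion X f \<U> d \<delta>m \<delta>p \<longleftrightarrow>
     (\<forall>n0 n1 k. \<forall>U0\<in>pullback_cover X f \<U> n0. \<forall>U1\<in>pullback_cover X f \<U> n1.
        \<forall>W0\<in>pullback_cover X f \<U> (n0 + k). \<forall>W1\<in>pullback_cover X f \<U> (n1 + k).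
          U1 \<subseteq> U0 \<and> W1 \<subseteq> W0 \<and> (f ^^ k) ` W0 = U0 \<and> (f ^^ k) ` W1 = U1 \<longrightarrow>
          mdiameter d W1 / mdiameter d W0 < \<delta>m (mdiameter d U1 / mdiameter d U0) \<and>
          mdiameter d U1 / mdiameter d U0 < \<delta>p (mdiameter d W1 / mdiameter d W0))"

definition metric_cxc :: "'a topology \<Rightarrow> ('a \<Rightarrow> 'a) \<Rightarrow> 'a metric \<Rightarrow> bool" where
  "metric_cxc X f d \<longleftrightarrow>
     mtopology_of d = X \<and>
     (\<exists>\<U>. topological_cxc_wrt X f \<U> \<and>
        (\<exists>\<rho>m \<rho>p \<delta>m \<delta>p.
           roundness_gauge \<rho>m \<and> roundness_gauge \<rho>p \<and> diameter_gauge \<delta>m \<and> diameter_gauge \<delta>p \<and>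
           roundness_distortion X f \<U> d \<rho>m \<rho>p \<and> diameter_distortion X f \<U> d \<delta>m \<delta>p))"

definition canonical_gauge :: "'a topology \<Rightarrow> ('a \<Rightarrow> 'a) \<Rightarrow> 'a metric set" where
  "canonical_gauge X f = {d. metric_cxc X f d}"

section \<open>Hausdorff dimension\<close>

text \<open>The \<open>s\<close>-th power of the diameter, with the usual conventions that the empty set
  contributes 0 and that \<open>0\<^sup>0 = 1\<close> for nonempty sets (whereas \<open>0 powr 0 = 0\<close> in HOL).\<close>

definition diameter_power :: "'a metric \<Rightarrow> real \<Rightarrow> 'a set \<Rightarrow> real" where
  "diameter_power d s E =
     (if E = {} then 0 else if s = 0 then 1 else mdiameter d E powr s)"

definition hausdorff_premeasure :: "'a metric \<Rightarrow> real \<Rightarrow> real \<Rightarrow> 'a set \<Rightarrow> ennreal" where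
  "hausdorff_premeasure d s \<epsilon> A =
     (INF E\<in>{E :: nat \<Rightarrow> 'a set. A \<subseteq> (\<Union>i. E i) \<and>
               (\<forall>i. Metric_space.mbounded (mspace d) (mdist d) (E i) \<and> mdiameter d (E i) \<le> \<epsilon>)}.
        \<Sum>i. ennreal (diameter_power d s (E i)))"

definition hausdorff_measure :: "'a metric \<Rightarrow> real \<Rightarrow> 'a set \<Rightarrow> ennreal" where
  "hausdorff_measure d s A = (SUP \<epsilon>\<in>{0<..}. hausdorff_premeasure d s \<epsilon> A)"

definition hausdorff_dimension :: "'a metric \<Rightarrow> ennreal" where
  "hausdorff_dimension d =
     Inf {ennreal s | s. 0 \<le> s \<and> hausdorff_measure d s (mspace d) = 0}"

end

theory Submission
  imports Defs
begin

text \<open>Irreducibility puts a triod into every member of \<open>\<U>\<^sub>0\<close>, and lifting it through \<open>f\<^sup>n\<close> and using the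
  distortion axioms puts one with well separated ends into every ball of \<open>X\<close>, at a scale comparable
  to the radius.  Of its three ends, one has the middle distance from a given base point \<open>x\<^sub>0\<close>, and
  the connected union of the other two legs attains that distance too: at every place and scale
  there are two points that are equidistant from \<open>x\<^sub>0\<close> but far from each other.

  Now let \<open>K\<close> be a continuum along which the distance from \<open>x\<^sub>0\<close> grows by \<open>r\<close>.  Subcontinua over
  disjoint intervals of this distance have sizes adding up to nearly \<open>r\<close>, and the gaps can be made
  negligible.  If two equidistant points as above are close to the middle piece, that piece is larger
  than its interval; otherwise one of them lies on a further continuum away from all these pieces.
  Either way there are separated subcontinua of total size at least \<open>(1 + \<epsilon>) r\<close>.  Iterating bounds the sums of
  \<open>s\<close>-th powers of diameters over finite covers from below for some \<open>s > 1\<close>.\<close>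

section \<open>Crossing continua\<close>

text \<open>Boundary bumping: in a continuum, the component of \<open>x\<close> in a proper closed
  subset meets the frontier of that subset. For the sublevel set \<open>u \<le> b\<close> this
  frontier lies in the level \<open>b\<close>.\<close>

lemma crossing_continuum_above:
  fixes u :: "'a \<Rightarrow> real"
  assumes X: "Hausdorff_space X" and K: "compactin X K" "connectedin X K"
    and u: "continuous_map X euclideanreal u"
    and x: "x \<in> K" "u x \<le> b" and y: "y \<in> K" "b \<le> u y"
  obtains C where "compactin X C" "connectedin X C" "C \<subseteq> K" "x \<in> C" "\<forall>z\<in>C. u z \<le> b" "\<exists>w\<in>C. u w = b"
proof -
  define Y where "Y = subtopology X K"
  define S where "S = {z \<in> K. u z \<le> b}"
  have KX: "K \<subseteq> topspace X" using K connectedin_subset_topspace by blast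
  have tY: "topspace Y = K" using KX by (auto simp: Y_def)
  have cuY: "continuous_map Y euclideanreal u" unfolding Y_def by (rule continuous_map_from_subtopology[OF u])
  have Y: "connected_space Y" "compact_space Y" "Hausdorff_space Y"
    using K X by (auto simp: Y_def connectedin_def compact_space_subtopology Hausdorff_space_subtopology)
  have "closedin Y {z \<in> topspace Y. u z \<in> {..b}}"
    by (rule closedin_continuous_map_preimage[OF cuY]) simp
  then have clS: "closedin Y S" by (simp add: tY S_def)
  show thesis
  proof (cases "S = K")
    \<comment> \<open>The whole continuum lies below the level; then \<open>y\<close> is at height
      exactly \<open>b\<close>, and \<open>K\<close> itself serves.\<close>
    case True
    then have "\<forall>z\<in>K. u z \<le> b" by (auto simp: S_def)
    moreover from this have "u y = b" using y by fastforce
    ultimately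
    show thesis using that[of K] K x y by blast
  next
    case False
    define C where "C = connected_component_of_set (subtopology Y S) x"
    have xS: "x \<in> topspace (subtopology Y S)" using x by (auto simp: tY S_def)
    then have C: "C \<in> connected_components_of (subtopology Y S)"
      by (simp add: C_def connected_component_in_connected_components_of)
    from boundary_bumping_theorem_closed[OF Y clS _ C] False tY
    obtain w where w: "w \<in> C" "w \<in> Y frontier_of S" by auto
    have CS: "C \<subseteq> S" using connected_components_of_subset[OF C] by auto
    have "u w = b"
    \<comment> \<open>A point with \<open>u < b\<close> is interior to \<open>S\<close>, so it
      cannot be a frontier point.\<close>
    proof (rule ccontr)
      assume "u w \<noteq> b"
      then have wb: "u w < b" using w CS by (auto simp: S_def)
      have "openin Y {z \<in> topspace Y. u z \<in> {..<b}}"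
        by (rule openin_continuous_map_preimage[OF cuY]) simp
      moreover have "{z \<in> topspace Y. u z \<in> {..<b}} \<subseteq> S" by (auto simp: S_def tY)
      moreover have "w \<in> {z \<in> topspace Y. u z \<in> {..<b}}" using w CS wb by (auto simp: S_def tY)
      ultimately have "w \<in> Y interior_of S" by (meson interior_of_maximal subsetD)
      then show False using w by (simp add: frontier_of_def)
    qed
    moreover have "closedin (subtopology Y S) C" using C by (rule closedin_connected_components_of)
    then have "closedin Y C" using clS by (meson closedin_trans_full)
    then have "compactin Y C" using Y closedin_compact_space by blast
    then have "compactin X C" by (simp add: Y_def compactin_subtopology)
    moreover have "connectedin (subtopology Y S) C" using C by (rule connectedin_connected_components_of)
    then have "connectedin X C" by (simp add: Y_def connectedin_subtopology)
    moreover have "x \<in> C" using xS by (simp add: C_def connected_component_of_refl)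
    ultimately show thesis using that[of C] w CS by (auto simp: S_def)
  qed
qed

text \<open>The one-sided version is used twice: from \<open>x\<close> up to a point
  \<open>w\<close> at height \<open>b\<close>, then with \<open>-u\<close> from \<open>w\<close>
  back down to height \<open>a\<close>, inside the continuum found first.\<close>

lemma crossing_continuum:
  fixes u :: "'a \<Rightarrow> real"
  assumes X: "Hausdorff_space X" and K: "compactin X K" "connectedin X K"
    and u: "continuous_map X euclideanreal u"
    and x: "x \<in> K" "u x \<le> a" and y: "y \<in> K" "b \<le> u y" and "a \<le> b"
  obtains C where "compactin X C" "connectedin X C" "C \<subseteq> K" "\<forall>z\<in>C. a \<le> u z \<and> u z \<le> b"
    "\<exists>w\<in>C. u w = a" "\<exists>w\<in>C. u w = b"
proof -
  obtain C where C: "compactin X C" "connectedin X C" "C \<subseteq> K" "x \<in> C" "\<forall>z\<in>C. u z \<le> b" "\<exists>w\<in>C. u w = b"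
    using crossing_continuum_above[OF X K u x(1) _ y] x \<open>a \<le> b\<close> by auto
  then obtain w where w: "w \<in> C" "u w = b" by blast
  have "continuous_map X euclideanreal (\<lambda>z. - u z)" using u by (intro continuous_intros)
  then obtain D where "compactin X D" "connectedin X D" "D \<subseteq> C" "w \<in> D" "\<forall>z\<in>D. - u z \<le> - a" "\<exists>w\<in>D. - u w = - a"
    using crossing_continuum_above[OF X C(1,2) _ w(1) _ C(4), of "\<lambda>z. - u z" "-a"] w x \<open>a \<le> b\<close> by auto
  then show thesis using that[of D] C w by auto
qed

section \<open>Metric spaces that are forked at all scales\<close>

context Metric_space
begin

text \<open>\<open>b - a\<close> serves as the size of \<open>K\<close> seen from \<open>x0\<close>.
  \<open>K\<close> may leave the shell between the radii \<open>a\<close> and \<open>b\<close>, so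
  the whole space can be the first continuum, and one continuum can be measured again from another
  base point.\<close>

definition spans :: "'a set \<Rightarrow> 'a \<Rightarrow> real \<Rightarrow> real \<Rightarrow> bool" where
  "spans K x0 a b \<longleftrightarrow> compactin mtopology K \<and> connectedin mtopology K \<and> x0 \<in> M \<and> a < b \<and>
     (\<exists>x\<in>K. d x0 x = a) \<and> (\<exists>y\<in>K. b \<le> d x0 y)"

text \<open>A slab is confined in two ways.  Since the pieces of a continuum that keep its base point
  \<open>x0\<close> also stay in disjoint intervals of the distance from \<open>x0\<close>, the gaps between their slabs may be
  far smaller than the thickness of the slabs.\<close>

definition slab :: "'a set \<Rightarrow> 'a \<Rightarrow> real \<Rightarrow> real \<Rightarrow> 'a set" where
  "slab K x0 a b = {z \<in> M. a \<le> d x0 z \<and> d x0 z \<le> b \<and> (\<exists>k\<in>K. d k z \<le> (b - a) / 2000)}"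

text \<open>The base point \<open>x0\<close> is arbitrary and unrelated to the ball, because the
  subdivision below changes base points and is then repeated.\<close>

definition forked :: "real \<Rightarrow> real \<Rightarrow> bool" where
  "forked c r0 \<longleftrightarrow> (\<forall>p\<in>M. \<forall>\<rho>. 0 < \<rho> \<and> \<rho> \<le> r0 \<longrightarrow> (\<forall>x0\<in>M. \<exists>e\<in>mball p \<rho>. \<exists>q\<in>mball p \<rho>.
      d x0 e = d x0 q \<and> c * \<rho> \<le> d e q))"

lemma lipschitz_dist: "\<lbrakk>x \<in> M; y \<in> M; z \<in> M\<rbrakk> \<Longrightarrow> \<bar>d x y - d x z\<bar> \<le> d y z"
  using triangle[of x y z] triangle[of x z y] commute[of y z] by linarith

lemma continuous_map_dist: "x0 \<in> M \<Longrightarrow> continuous_map mtopology euclideanreal (d x0)"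
  using continuous_map_mdist[of mtopology Self "\<lambda>_. x0" id] by (simp add: Self_def)

lemma spans_in_M: "spans K x0 a b \<Longrightarrow> K \<subseteq> M"
  using connectedin_subset_topspace by (fastforce simp: spans_def)

lemma spans_subinterval:
  assumes K: "spans K x0 a b" and ab: "a \<le> a'" "a' < b'" "b' \<le> b"
  obtains C where "spans C x0 a' b'" "C \<subseteq> K" "\<And>z. z \<in> C \<Longrightarrow> a' \<le> d x0 z \<and> d x0 z \<le> b'"
proof -
  obtain x y where xy: "x \<in> K" "d x0 x = a" "y \<in> K" "b \<le> d x0 y" and x0: "x0 \<in> M"
    and "compactin mtopology K" "connectedin mtopology K"
    using K by (auto simp: spans_def)
  with ab crossing_continuum[OF Hausdorff_space_mtopology _ _ continuous_map_dist, of K x0 x a' y b']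
  obtain C where "compactin mtopology C" "connectedin mtopology C" "C \<subseteq> K" "\<forall>z\<in>C. a' \<le> d x0 z \<and> d x0 z \<le> b'"
    "\<exists>w\<in>C. d x0 w = a'" "\<exists>w\<in>C. d x0 w = b'"
    by (smt (verit))
  then show thesis using that[of C] x0 ab by (auto simp: spans_def) 
qed

lemma spans_intermediate:
  assumes K: "spans K x0 a b" and t: "a \<le> t" "t \<le> b"
  obtains x where "x \<in> K" "d x0 x = t"
proof (cases "t < b")
  case True
  then show thesis using spans_subinterval[OF K t(1) True] that by (smt (verit, best) spans_def subsetD)
next
  \<comment> \<open>There is no subinterval to the right of \<open>b\<close>; the upper end of the
    piece over the full interval is at distance exactly \<open>b\<close>.\<close>
  case False
  then have "t = b" "a < b" using t K by (auto simp: spans_def)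
  then show thesis using spans_subinterval[OF K _ _ order_refl, of a] that
    by (smt (verit, best) spans_def subsetD)
qed

lemma slab_mono:
  assumes "C \<subseteq> K" "a \<le> a'" "b' \<le> b"
  shows "slab C x0 a' b' \<subseteq> slab K x0 a b"
proof
  fix z assume z: "z \<in> slab C x0 a' b'"
  then obtain k where "k \<in> C" "d k z \<le> (b' - a') / 2000" by (auto simp: slab_def)
  then have "k \<in> K" "d k z \<le> (b - a) / 2000" using assms by auto
  then show "z \<in> slab K x0 a b" using z assms by (auto simp: slab_def)
qed

text \<open>Three pieces of \<open>K\<close>, over intervals below, around and above the level
  \<open>t\<close> of a fork, have total size \<open>r - \<theta>/8\<close>: each of the two gaps
  costs \<open>\<theta>/16\<close>. The fork gains more than that: a fourth piece of size
  \<open>\<theta>\<close>, or a middle piece counted as \<open>36\<theta>\<close> instead of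
  \<open>10\<theta>\<close>. So the total is at least \<open>r + \<theta>/2\<close>. The value of
  \<open>\<kappa>\<close> makes the ends of a fork in a ball of radius \<open>r/4000\<close> at
  least \<open>40\<theta>\<close> apart.\<close>

lemma subslabs:
  assumes cH: "forked c r0" and c: "0 < c" "c \<le> 1"
    and far: "\<And>z. z \<in> M \<Longrightarrow> \<exists>y\<in>M. r0 \<le> d z y"
    and X: "compact_space mtopology" "connected_space mtopology"
    and K: "spans K x0 a b" and r0: "b - a \<le> r0"
    and \<kappa>: "\<kappa> = c / 160000"
  obtains I :: "nat set" and K' x' a' b' where
    "finite I" "\<And>i. i \<in> I \<Longrightarrow> spans (K' i) (x' i) (a' i) (b' i)"
    "\<And>i. i \<in> I \<Longrightarrow> slab (K' i) (x' i) (a' i) (b' i) \<subseteq> slab K x0 a b"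
    "\<And>i. i \<in> I \<Longrightarrow> \<kappa> * (b - a) \<le> b' i - a' i \<and> b' i - a' i \<le> 3/4 * (b - a)"
    "\<And>i j y z. \<lbrakk>i \<in> I; j \<in> I; i < j; y \<in> slab (K' i) (x' i) (a' i) (b' i); z \<in> slab (K' j) (x' j) (a' j) (b' j)\<rbrakk>
       \<Longrightarrow> \<kappa> * (b - a) / 32 \<le> d y z"
    "(\<Sum>i\<in>I. b' i - a' i) \<ge> (1 + \<kappa> / 2) * (b - a)"
proof -
  define r where "r = b - a"
  define \<theta> where "\<theta> = \<kappa> * r"
  have r: "0 < r" using K by (simp add: r_def spans_def)
  have x0: "x0 \<in> M" using K by (simp add: spans_def)
  have KM: "K \<subseteq> M" using spans_in_M[OF K] .
  have \<theta>: "0 < \<theta>" "160000 * \<theta> \<le> r" "c * (r / 4000) = 40 * \<theta>"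
    using c r by (auto simp: \<theta>_def \<kappa>)
  \<comment> \<open>The fork is placed around a point at the middle level, so the outer two pieces
    each have size about \<open>r/2\<close>, safely below \<open>3/4 * r\<close>.\<close>
  obtain p where p: "p \<in> K" "d x0 p = a + r / 2"
    using spans_intermediate[OF K, of "a + r/2"] r by (auto simp: r_def field_simps)
  have pM: "p \<in> M" using p KM by blast
  have "0 < r / 4000" "r / 4000 \<le> r0" using r r0 by (auto simp: r_def)
  with cH pM x0 obtain e q where eq: "e \<in> mball p (r/4000)" "q \<in> mball p (r/4000)" "d x0 e = d x0 q"
    "40 * \<theta> \<le> d e q"
    unfolding forked_def \<theta>(3)[symmetric] by meson
  define t where "t = d x0 e"
  have eqM: "e \<in> M" "q \<in> M" "d p e < r/4000" "d p q < r/4000" using eq by auto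
  have t: "\<bar>t - (a + r/2)\<bar> < r / 4000"
    using lipschitz_dist[OF x0 eqM(1) pM] eqM p commute[of e p] by (auto simp: t_def)
  have tb: "a < t - 5*\<theta> - \<theta>/16" "t + 5*\<theta> + \<theta>/16 < b" "b = a + r"
    using t \<theta> r by (auto simp: r_def abs_if field_simps split: if_splits)
  have t': "a + r/2 - r/4000 < t" "t < a + r/2 + r/4000" using t by linarith+
  obtain C1 where C1: "spans C1 x0 a (t - 5*\<theta> - \<theta>/16)" "C1 \<subseteq> K"
      "\<And>z. z \<in> C1 \<Longrightarrow> a \<le> d x0 z \<and> d x0 z \<le> t - 5*\<theta> - \<theta>/16"
    by (rule spans_subinterval[OF K, of a "t - 5*\<theta> - \<theta>/16"]) (use tb \<theta> in auto)
  obtain C2 where C2: "spans C2 x0 (t - 5*\<theta>) (t + 5*\<theta>)" "C2 \<subseteq> K"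
      "\<And>z. z \<in> C2 \<Longrightarrow> t - 5*\<theta> \<le> d x0 z \<and> d x0 z \<le> t + 5*\<theta>"
    by (rule spans_subinterval[OF K, of "t - 5*\<theta>" "t + 5*\<theta>"]) (use tb \<theta> in auto)
  obtain C3 where C3: "spans C3 x0 (t + 5*\<theta> + \<theta>/16) b" "C3 \<subseteq> K"
      "\<And>z. z \<in> C3 \<Longrightarrow> t + 5*\<theta> + \<theta>/16 \<le> d x0 z \<and> d x0 z \<le> b"
    by (rule spans_subinterval[OF K, of "t + 5*\<theta> + \<theta>/16" b]) (use tb \<theta> in auto)
  have CM: "C1 \<subseteq> M" "C2 \<subseteq> M" "C3 \<subseteq> M" using C1(2) C2(2) C3(2) KM by auto
  have s1: "slab C1 x0 a (t - 5*\<theta> - \<theta>/16) \<subseteq> slab K x0 a b"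
    by (rule slab_mono) (use C1(2) tb \<theta> in auto)
  have s3: "slab C3 x0 (t + 5*\<theta> + \<theta>/16) b \<subseteq> slab K x0 a b"
    by (rule slab_mono) (use C3(2) tb \<theta> in auto)
  \<comment> \<open>The distance from \<open>x0\<close> is 1-Lipschitz, so slabs over separated
    intervals are separated in space.\<close>
  have sep: "\<theta> / 32 \<le> d y z" if "y \<in> M" "z \<in> M" "d x0 y + \<theta>/32 \<le> d x0 z" for y z
    using lipschitz_dist[OF x0 that(1,2)] that(3) by linarith
  have sep': "\<theta> / 32 \<le> d y z" if "y \<in> M" "z \<in> M" "d x0 z + \<theta>/32 \<le> d x0 y" for y z
    using lipschitz_dist[OF x0 that(1,2)] that(3) by linarith
  have near: "\<bar>d x0 z - d x0 k\<bar> \<le> \<epsilon>" if "z \<in> M" "k \<in> M" "d k z \<le> \<epsilon>" for z k \<epsilon>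
    using lipschitz_dist[OF x0 that(2,1)] that(3) by linarith
  have total: "(1 + \<kappa>/2) * (b - a) = r + \<theta>/2" by (simp add: \<theta>_def r_def distrib_right)
  show thesis
  proof (cases "\<exists>z\<in>{e,q}. \<forall>w\<in>C2. 2*\<theta> \<le> d w z")
    case True
    \<comment> \<open>A continuum \<open>D\<close> of size \<open>\<theta>\<close> around \<open>z\<close> is a fourth piece.\<close>
    then obtain z where z: "z \<in> M" "d p z < r/4000" "d x0 z = t" "\<And>w. w \<in> C2 \<Longrightarrow> 2*\<theta> \<le> d w z"
      using eqM eq(3) by (auto simp: t_def)
    \<comment> \<open>\<open>D\<close> is cut out of the whole space, which is a continuum
      containing \<open>z\<close> and a point at distance at least \<open>\<theta>\<close> from it;
      \<open>D\<close> need not lie in \<open>K\<close>.\<close>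
    have "\<exists>y\<in>M. \<theta> \<le> d z y" using far[OF z(1)] r0 \<theta> r by (smt (verit) r_def)
    then have "spans M z 0 \<theta>"
      using z(1) \<theta>(1) X mdist_zero[OF z(1)] unfolding spans_def
      by (metis compact_space_def connectedin_topspace topspace_mtopology)
    then obtain D where D: "spans D z 0 \<theta>" "\<And>w. w \<in> D \<Longrightarrow> d z w \<le> \<theta>"
      by (rule spans_subinterval[of M z 0 \<theta> 0 \<theta>]) (use \<theta>(1) in auto)
    have DM: "D \<subseteq> M" using spans_in_M[OF D(1)] .
    have s2: "slab C2 x0 (t - 5*\<theta>) (t + 5*\<theta>) \<subseteq> slab K x0 a b"
      by (rule slab_mono) (use C2(2) tb \<theta> in auto)
    have nD: "y \<in> M \<and> d z y \<le> 2*\<theta> \<and> (\<exists>k\<in>D. d k y \<le> \<theta>/2000)" if "y \<in> slab D z 0 \<theta>" for y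
    proof -
      obtain k where k: "k \<in> D" "d k y \<le> \<theta>/2000" "y \<in> M" using \<open>y \<in> slab D z 0 \<theta>\<close> by (auto simp: slab_def)
      moreover have "d z y \<le> 2*\<theta>"
        using triangle[OF z(1) subsetD[OF DM k(1)] k(3)] D(2)[OF k(1)] k(2) \<theta>(1) by linarith
      ultimately show ?thesis by auto
    qed
    have uD: "\<bar>d x0 y - t\<bar> \<le> 2*\<theta>" if "y \<in> slab D z 0 \<theta>" for y
      using near[of y z] nD[OF that] z by auto
    \<comment> \<open>Points of this slab are within \<open>r/4000 + 2*\<theta>\<close> of
      \<open>p \<in> K\<close>, hence within the thickness \<open>r/2000\<close> of the big slab.
      This is why the fork is taken at radius \<open>r/4000\<close>.\<close>
    have s4: "slab D z 0 \<theta> \<subseteq> slab K x0 a b"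
    proof
      fix y assume y: "y \<in> slab D z 0 \<theta>"
      have "d p y \<le> r / 2000"
        using triangle[OF pM z(1), of y] nD[OF y] z(2) \<theta> by linarith
      then show "y \<in> slab K x0 a b"
        using nD[OF y] uD[OF y] p(1) tb \<theta> by (auto simp: slab_def)
    qed
    \<comment> \<open>These two slabs overlap in their distances from \<open>x0\<close> and are
      separated in space instead: \<open>z\<close> is \<open>2\<theta>\<close> away from
      \<open>C2\<close>, \<open>D\<close> reaches only \<open>\<theta>\<close> from
      \<open>z\<close>, and the thicknesses are \<open>\<theta>/200\<close> and
      \<open>\<theta>/2000\<close>.\<close>
    have sep24: "\<theta>/32 \<le> d y w" if y: "y \<in> slab C2 x0 (t - 5*\<theta>) (t + 5*\<theta>)" and w: "w \<in> slab D z 0 \<theta>" for y w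
    proof -
      obtain k where k: "k \<in> C2" "d k y \<le> \<theta>/200" "y \<in> M" using y by (auto simp: slab_def)
      obtain l where l: "l \<in> D" "d l w \<le> \<theta>/2000" "w \<in> M" using nD[OF w] by auto
      have M: "k \<in> M" "l \<in> M" using k l CM DM by auto
      have "d k z \<le> d k y + d y w + d l w + d z l"
        using triangle[OF M(1) k(3) z(1)] triangle[OF k(3) l(3) z(1)] triangle[OF l(3) M(2) z(1)]
          commute[of w l] commute[of l z] by linarith
      then show ?thesis using z(4)[OF k(1)] D(2)[OF l(1)] k(2) l(2) \<theta>(1) by linarith
    qed
    \<comment> \<open>The slab of \<open>D\<close> stays within \<open>2\<theta>\<close> of the
      level \<open>t\<close>, while the outer pieces begin beyond \<open>5\<theta>\<close> from
      it.\<close>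
    have sD: "\<theta>/32 \<le> d y w" if y: "y \<in> M" "d x0 y \<le> t - 5*\<theta> - \<theta>/16" and w: "w \<in> slab D z 0 \<theta>" for y w
      using sep[of y w] y uD[OF w] nD[OF w] \<theta>(1) by auto
    have sD': "\<theta>/32 \<le> d y w" if y: "y \<in> M" "d x0 y \<ge> t + 5*\<theta> + \<theta>/16" and w: "w \<in> slab D z 0 \<theta>" for y w
      using sep'[of y w] y uD[OF w] nD[OF w] \<theta>(1) by auto
    define K' where "K' = (\<lambda>i::nat. if i = 0 then C1 else if i = 1 then C2 else if i = 2 then C3 else D)"
    define x' where "x' = (\<lambda>i::nat. if i = 3 then z else x0)"
    define a' where "a' = (\<lambda>i::nat. if i = 0 then a else if i = 1 then t - 5*\<theta> else if i = 2 then t + 5*\<theta> + \<theta>/16 else 0)"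
    define b' where "b' = (\<lambda>i::nat. if i = 0 then t - 5*\<theta> - \<theta>/16 else if i = 1 then t + 5*\<theta> else if i = 2 then b else \<theta>)"
    note defs = K'_def x'_def a'_def b'_def
    show thesis
    proof (rule that[of "{0,1,2,3}" K' x' a' b'], goal_cases)
      case 1 then show ?case by simp
    next
      case (2 i) then show ?case using C1(1) C2(1) C3(1) D(1) by (auto simp: defs)
    next
      case (3 i) then show ?case using s1 s2 s3 s4 by (auto simp: defs)
    next
      case (4 i) then show ?case using tb(3) \<theta>(1,2) t' by (auto simp: defs \<theta>_def[symmetric] r_def[symmetric])
    next
      case (5 i j y w)
      let ?S0 = "slab C1 x0 a (t - 5*\<theta> - \<theta>/16)" and ?S1 = "slab C2 x0 (t - 5*\<theta>) (t + 5*\<theta>)"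
        and ?S2 = "slab C3 x0 (t + 5*\<theta> + \<theta>/16) b"
      have "\<theta>/32 \<le> d y w" if "y \<in> ?S0" "w \<in> ?S1" using that \<theta>(1) by (intro sep) (auto simp: slab_def)
      moreover have "\<theta>/32 \<le> d y w" if "y \<in> ?S0" "w \<in> ?S2" using that \<theta>(1) by (intro sep) (auto simp: slab_def)
      moreover have "\<theta>/32 \<le> d y w" if "y \<in> ?S1" "w \<in> ?S2" using that \<theta>(1) by (intro sep) (auto simp: slab_def)
      moreover have "\<theta>/32 \<le> d y w" if "y \<in> ?S0" "w \<in> slab D z 0 \<theta>" using that by (intro sD) (auto simp: slab_def)
      moreover have "\<theta>/32 \<le> d y w" if "y \<in> ?S2" "w \<in> slab D z 0 \<theta>" using that by (intro sD') (auto simp: slab_def)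
      moreover note sep24[of y w]
      moreover have "i = 0 \<and> j = 1 \<or> i = 0 \<and> j = 2 \<or> i = 0 \<and> j = 3 \<or> i = 1 \<and> j = 2 \<or> i = 1 \<and> j = 3 \<or> i = 2 \<and> j = 3"
        using 5(1-3) by auto
      ultimately have "\<theta>/32 \<le> d y w" using 5(4,5) by (elim disjE conjE) (simp_all add: defs)
      then show ?case by (simp add: \<theta>_def r_def)
    next
      case 6 then show ?case unfolding total by (simp add: defs) (use \<theta>(1) tb(3) in linarith)
    qed
  next
    case False
    \<comment> \<open>\<open>C2\<close> has size \<open>36\<theta>\<close> when measured from \<open>q'\<close>, although its interval has length \<open>10\<theta>\<close>.\<close>
    then obtain e' q' where e': "e' \<in> C2" "d e' e < 2*\<theta>" and q': "q' \<in> C2" "d q' q < 2*\<theta>"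
      by (auto simp: not_le)
    have e'M: "e' \<in> M" "q' \<in> M" using e' q' CM by auto
    \<comment> \<open>Of the fork's separation \<open>40\<theta>\<close>, replacing each end by a
      nearby point of \<open>C2\<close> loses less than \<open>2\<theta>\<close>.\<close>
    have "d e q \<le> d e' e + d e' q' + d q' q"
      using triangle[OF eqM(1) e'M(1) eqM(2)] triangle[OF e'M eqM(2)] commute[of e e'] by linarith
    then have "36 * \<theta> \<le> d q' e'" using eq(4) e' q' commute[of q' e'] by linarith
    then have D: "spans C2 q' 0 (36*\<theta>)" using C2(1) e'(1) q'(1) e'M \<theta>(1) mdist_zero[OF e'M(2)] unfolding spans_def by fastforce
    have nD: "y \<in> M \<and> (\<exists>k\<in>C2. d k y \<le> \<theta>/50)" if y: "y \<in> slab C2 q' 0 (36*\<theta>)" for y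
    proof -
      obtain k where "k \<in> C2" "d k y \<le> (36*\<theta> - 0)/2000" "y \<in> M" using y by (auto simp: slab_def)
      moreover from this have "d k y \<le> \<theta>/50" using \<theta>(1) by (simp add: field_simps)
      ultimately show ?thesis by blast
    qed
    have uD: "t - 5*\<theta> - \<theta>/50 \<le> d x0 y \<and> d x0 y \<le> t + 5*\<theta> + \<theta>/50" if y: "y \<in> slab C2 q' 0 (36*\<theta>)" for y
    proof -
      obtain k where k: "k \<in> C2" "d k y \<le> \<theta>/50" "y \<in> M" using nD[OF y] by blast
      have "k \<in> M" using k(1) CM by auto
      then show ?thesis using near[OF k(3) _ k(2)] C2(3)[OF k(1)] unfolding abs_le_iff by linarith
    qed
    have s2: "slab C2 q' 0 (36*\<theta>) \<subseteq> slab K x0 a b"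
    proof
      fix y assume y: "y \<in> slab C2 q' 0 (36*\<theta>)"
      then obtain k where k: "k \<in> C2" "d k y \<le> \<theta>/50" "y \<in> M" using nD by blast
      then have "k \<in> K" "d k y \<le> r / 2000" using C2(2) \<theta> by auto
      then show "y \<in> slab K x0 a b"
        using k(3) uD[OF y] tb \<theta>(1) by (auto simp: slab_def simp del: divide_le_eq_numeral1 le_divide_eq_numeral1)
    qed
    define K' where "K' = (\<lambda>i::nat. if i = 0 then C1 else if i = 1 then C2 else C3)"
    define x' where "x' = (\<lambda>i::nat. if i = 1 then q' else x0)"
    define a' where "a' = (\<lambda>i::nat. if i = 0 then a else if i = 1 then 0 else t + 5*\<theta> + \<theta>/16)"
    define b' where "b' = (\<lambda>i::nat. if i = 0 then t - 5*\<theta> - \<theta>/16 else if i = 1 then 36*\<theta> else b)"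
    note defs = K'_def x'_def a'_def b'_def
    \<comment> \<open>With the new base point the middle slab is no longer confined to its interval,
      but it exceeds it by at most \<open>\<theta>/50\<close>; the gap \<open>\<theta>/16\<close>
      still leaves \<open>\<theta>/32\<close>.\<close>
    have s12: "\<theta>/32 \<le> d y w" if y: "y \<in> M" "d x0 y \<le> t - 5*\<theta> - \<theta>/16" and w: "w \<in> slab C2 q' 0 (36*\<theta>)" for y w
      using sep[of y w] y uD[OF w] nD[OF w] \<theta>(1) by auto
    have s23: "\<theta>/32 \<le> d w y" if y: "y \<in> M" "d x0 y \<ge> t + 5*\<theta> + \<theta>/16" and w: "w \<in> slab C2 q' 0 (36*\<theta>)" for y w
      using sep[of w y] y uD[OF w] nD[OF w] \<theta>(1) by auto
    show thesis
    proof (rule that[of "{0,1,2}" K' x' a' b'], goal_cases)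
      case 1 then show ?case by simp
    next
      case (2 i) then show ?case using C1(1) D C3(1) by (auto simp: defs)
    next
      case (3 i) then show ?case using s1 s2 s3 by (auto simp: defs)
    next
      case (4 i) then show ?case using tb(3) \<theta>(1,2) t' by (auto simp: defs \<theta>_def[symmetric] r_def[symmetric])
    next
      case (5 i j y w)
      let ?S0 = "slab C1 x0 a (t - 5*\<theta> - \<theta>/16)" and ?S2 = "slab C3 x0 (t + 5*\<theta> + \<theta>/16) b"
      have "\<theta>/32 \<le> d y w" if "y \<in> ?S0" "w \<in> ?S2" using that \<theta>(1) by (intro sep) (auto simp: slab_def)
      moreover have "\<theta>/32 \<le> d y w" if "y \<in> ?S0" "w \<in> slab C2 q' 0 (36*\<theta>)" using that by (intro s12) (auto simp: slab_def)
      moreover have "\<theta>/32 \<le> d y w" if "w \<in> ?S2" "y \<in> slab C2 q' 0 (36*\<theta>)" using that by (intro s23) (auto simp: slab_def)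
      moreover have "i = 0 \<and> j = 1 \<or> i = 0 \<and> j = 2 \<or> i = 1 \<and> j = 2"
        using 5(1-3) by auto
      ultimately have "\<theta>/32 \<le> d y w" using 5(4,5) by (elim disjE conjE) (simp_all add: defs)
      then show ?case by (simp add: \<theta>_def r_def)
    next
      case 6 then show ?case unfolding total by (simp add: defs) (use \<theta>(1) tb(3) in linarith)
    qed
  qed
qed

section \<open>Lower bounds for finite covers by iterated subdivision\<close>

lemma slab_nonempty:
  assumes K: "spans K x0 a b"
  obtains z where "z \<in> slab K x0 a b"
proof -
  obtain x where x: "x \<in> K" "d x0 x = a" and ab: "a < b" using K by (auto simp: spans_def)
  have "x \<in> M" using x spans_in_M[OF K] by auto
  then have "x \<in> slab K x0 a b" using x ab mdist_zero[of x] by (auto simp: slab_def intro!: bexI[of _ x])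
  then show thesis by (rule that)
qed

text \<open>A single cover set with \<open>\<delta> j\<close> at least \<open>\<kappa>/32\<close>
  times the size of the slab already gives the bound. If all sets that meet the slab are smaller,
  none of them meets two of the separated subslabs, so the sum splits over these and the induction
  hypothesis applies to each. The number \<open>n\<close> bounds the depth: sizes shrink by
  \<open>3/4\<close> at each step, and no cover set counts as smaller than
  \<open>\<epsilon>\<close>.\<close>

lemma cover_sum_ge:
  assumes cH: "forked c r0" and c: "0 < c" "c \<le> 1"
    and far: "\<And>z. z \<in> M \<Longrightarrow> \<exists>y\<in>M. r0 \<le> d z y"
    and X: "compact_space mtopology" "connected_space mtopology"
    and \<kappa>: "\<kappa> = c / 160000"
    and s: "0 < s" "\<And>t. \<kappa> \<le> t \<Longrightarrow> t \<le> 1 \<Longrightarrow> t \<le> (1 + \<kappa>/2) * t powr s"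
    and J: "finite J" "M \<subseteq> (\<Union>j\<in>J. E j)"
    and E: "\<And>j x y. j \<in> J \<Longrightarrow> x \<in> E j \<Longrightarrow> y \<in> E j \<Longrightarrow> d x y \<le> \<delta> j"
    and \<epsilon>: "0 < \<epsilon>" "\<And>j. j \<in> J \<Longrightarrow> \<epsilon> \<le> \<delta> j"
    and K: "spans K x0 a b" "b - a \<le> r0" "b - a \<le> (4/3) ^ n * \<epsilon>"
  shows "(\<kappa> / 32 * (b - a)) powr s \<le> (\<Sum>j\<in>{j\<in>J. E j \<inter> slab K x0 a b \<noteq> {}}. \<delta> j powr s)"
proof -
  let ?J = "\<lambda>S. {j\<in>J. E j \<inter> S \<noteq> {}}"
  have \<kappa>01: "0 < \<kappa>" "\<kappa> \<le> 1" using c \<kappa> by auto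
  have single: "(\<kappa> / 32 * r) powr s \<le> (\<Sum>j\<in>?J S. \<delta> j powr s)"
    if j: "j \<in> ?J S" "\<kappa> * r / 32 \<le> \<delta> j" and r: "0 < r" for j S r
  proof -
    have "(\<kappa> / 32 * r) powr s \<le> \<delta> j powr s" using j(2) s(1) \<kappa>01 r by (intro powr_mono2) auto
    also have "\<dots> \<le> (\<Sum>j\<in>?J S. \<delta> j powr s)"
      using j(1) J(1) by (intro member_le_sum) auto
    finally show ?thesis .
  qed
  show ?thesis using K
  proof (induction n arbitrary: K x0 a b)
    case 0
    \<comment> \<open>The slab has size at most \<open>\<epsilon>\<close>, so any cover set that
      meets it is large enough on its own.\<close>
    obtain z where z: "z \<in> slab K x0 a b" using slab_nonempty[OF 0(1)] .
    then have "z \<in> M" by (simp add: slab_def)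
    then obtain j where j: "j \<in> J" "z \<in> E j" using J(2) by auto
    have r: "0 < b - a" using 0 by (simp add: spans_def)
    have "\<kappa> * (b - a) \<le> b - a" using r \<kappa>01 by (simp add: mult_left_le_one_le)
    then have "\<kappa> * (b - a) / 32 \<le> \<delta> j" using r 0(3)[unfolded power_0 mult_1] \<epsilon>(2)[OF j(1)] by linarith
    then show ?case using j z r by (intro single[of j]) auto
  next
    case (Suc n)
    define r where "r = b - a"
    have r: "0 < r" using Suc.prems by (simp add: r_def spans_def)
    show ?case
    proof (cases "\<exists>j\<in>?J (slab K x0 a b). \<kappa> * r / 32 \<le> \<delta> j")
      case True
      then obtain j where j: "j \<in> ?J (slab K x0 a b)" "\<kappa> * r / 32 \<le> \<delta> j" by auto
      show ?thesis using single[OF j r] by (simp add: r_def)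
    next
      case False
      obtain I :: "nat set" and K' x' a' b' where
        I: "finite I" "\<And>i. i \<in> I \<Longrightarrow> spans (K' i) (x' i) (a' i) (b' i)"
        "\<And>i. i \<in> I \<Longrightarrow> slab (K' i) (x' i) (a' i) (b' i) \<subseteq> slab K x0 a b"
        "\<And>i. i \<in> I \<Longrightarrow> \<kappa> * (b - a) \<le> b' i - a' i \<and> b' i - a' i \<le> 3/4 * (b - a)"
        "\<And>i j y z. \<lbrakk>i \<in> I; j \<in> I; i < j; y \<in> slab (K' i) (x' i) (a' i) (b' i); z \<in> slab (K' j) (x' j) (a' j) (b' j)\<rbrakk>
           \<Longrightarrow> \<kappa> * (b - a) / 32 \<le> d y z"
        "(\<Sum>i\<in>I. b' i - a' i) \<ge> (1 + \<kappa> / 2) * (b - a)"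
        using subslabs[OF cH c far X Suc.prems(1,2) \<kappa>] by blast
      define S where "S = (\<lambda>i. slab (K' i) (x' i) (a' i) (b' i))"
      define \<rho> where "\<rho> = (\<lambda>i. b' i - a' i)"
      \<comment> \<open>A set that meets two subslabs would have to bridge their separation
        \<open>\<kappa> * r / 32\<close>.\<close>
      have disj0: "?J (S i) \<inter> ?J (S j) = {}" if ij: "i \<in> I" "j \<in> I" "i < j" for i j
      proof (rule ccontr)
        assume "?J (S i) \<inter> ?J (S j) \<noteq> {}"
        then obtain l y z where l: "l \<in> J" "y \<in> E l" "y \<in> S i" "z \<in> E l" "z \<in> S j" by blast
        then have "\<kappa> * r / 32 \<le> \<delta> l" using I(5)[OF ij, of y z] E[of l y z] by (simp add: S_def r_def)
        moreover have "l \<in> ?J (slab K x0 a b)" using l I(3)[OF ij(1)] by (auto simp: S_def)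
        ultimately show False using False by blast
      qed
      have disj: "?J (S i) \<inter> ?J (S j) = {}" if "i \<in> I" "j \<in> I" "i \<noteq> j" for i j
      proof (cases "i < j")
        case True
        then show ?thesis by (rule disj0[OF that(1,2)])
      next
        case False
        then show ?thesis using disj0[OF that(2,1)] that(3) by (simp add: Int_commute)
      qed
      have child: "(\<kappa> / 32 * r) powr s * (\<rho> i / r) powr s \<le> (\<Sum>j\<in>?J (S i). \<delta> j powr s)" if i: "i \<in> I" for i
      proof -
        have "\<rho> i \<le> 3/4 * r" "\<kappa> * r \<le> \<rho> i" using I(4)[OF i] by (auto simp: \<rho>_def r_def)
        moreover have "r \<le> 4/3 * ((4/3) ^ n * \<epsilon>)" using Suc.prems(3) by (simp add: r_def)
        ultimately have "\<rho> i \<le> (4/3) ^ n * \<epsilon>" "\<rho> i \<le> r0" "0 < \<rho> i"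
          using Suc.prems(2) r mult_pos_pos[OF \<kappa>01(1) r] unfolding r_def[symmetric] by linarith+
        then have "(\<kappa> / 32 * \<rho> i) powr s \<le> (\<Sum>j\<in>?J (S i). \<delta> j powr s)"
          using Suc.IH[OF I(2)[OF i]] unfolding S_def \<rho>_def by blast
        moreover have "\<kappa> / 32 * \<rho> i = (\<kappa> / 32 * r) * (\<rho> i / r)" using r by simp
        ultimately show ?thesis
          using \<kappa>01 r \<open>0 < \<rho> i\<close> by (metis powr_mult)
      qed
      \<comment> \<open>The excess \<open>1 + \<kappa>/2\<close> of the total size pays for
        replacing the exponent 1 by \<open>s\<close>: this is the assumption on \<open>s\<close>,
        and the relative sizes lie between \<open>\<kappa>\<close> and 1.\<close>
      have "1 \<le> (\<Sum>i\<in>I. (\<rho> i / r) powr s)"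
      proof -
        have "(1 + \<kappa>/2) * 1 \<le> (\<Sum>i\<in>I. \<rho> i) / r" using I(6) r by (simp add: \<rho>_def r_def field_simps)
        also have "\<dots> = (\<Sum>i\<in>I. \<rho> i / r)" by (simp add: sum_divide_distrib)
        also have "\<dots> \<le> (\<Sum>i\<in>I. (1 + \<kappa>/2) * (\<rho> i / r) powr s)"
        proof (rule sum_mono)
          fix i assume i: "i \<in> I"
          show "\<rho> i / r \<le> (1 + \<kappa>/2) * (\<rho> i / r) powr s"
            by (rule s(2)) (use I(4)[OF i] r in \<open>simp_all add: \<rho>_def r_def field_simps\<close>)
        qed
        also have "\<dots> = (1 + \<kappa>/2) * (\<Sum>i\<in>I. (\<rho> i / r) powr s)" by (simp add: sum_distrib_left)
        finally show ?thesis using \<kappa>01 by (subst (asm) mult_le_cancel_left_pos) auto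
      qed
      then have "(\<kappa> / 32 * r) powr s \<le> (\<kappa> / 32 * r) powr s * (\<Sum>i\<in>I. (\<rho> i / r) powr s)"
        by (simp add: mult_le_cancel_left1)
      also have "\<dots> = (\<Sum>i\<in>I. (\<kappa> / 32 * r) powr s * (\<rho> i / r) powr s)" by (simp add: sum_distrib_left)
      also have "\<dots> \<le> (\<Sum>i\<in>I. \<Sum>j\<in>?J (S i). \<delta> j powr s)" by (rule sum_mono) (rule child)
      also have "\<dots> = (\<Sum>j\<in>(\<Union>i\<in>I. ?J (S i)). \<delta> j powr s)"
        using I(1) J(1) disj by (subst sum.UNION_disjoint) auto
      also have "\<dots> \<le> (\<Sum>j\<in>?J (slab K x0 a b). \<delta> j powr s)"
      proof (rule sum_mono2)
        show "(\<Union>i\<in>I. ?J (S i)) \<subseteq> ?J (slab K x0 a b)" using I(3) unfolding S_def by blast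
      qed (use J in auto)
      finally show ?thesis by (simp add: r_def)
    qed
  qed
qed

end

section \<open>Hausdorff dimension\<close>

lemma mdist_le_mdiameter:
  assumes "Metric_space.mbounded (mspace d) (mdist d) E" "x \<in> E" "y \<in> E"
  shows "mdist d x y \<le> mdiameter d E"
proof -
  interpret Metric_space "mspace d" "mdist d" by simp
  obtain B where "\<And>x y. x \<in> E \<Longrightarrow> y \<in> E \<Longrightarrow> mdist d x y \<le> B"
    using assms(1) unfolding mbounded_alt by blast
  then have "bdd_above ((\<lambda>(x,y). mdist d x y) ` (E \<times> E))" by (intro bdd_aboveI2[of _ _ B]) auto
  then have "(\<lambda>(x,y). mdist d x y) (x, y) \<le> (SUP (x,y)\<in>E \<times> E. mdist d x y)"
    using assms by (intro cSUP_upper) auto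
  then show ?thesis using assms by (auto simp: mdiameter_def)
qed

text \<open>A countable cover is enlarged to an open one at total cost \<open>e\<close> in the sum,
  and compactness leaves a finite subcover. The bound does not depend on the mesh of the cover, so
  it holds for every \<open>\<epsilon>\<close>.\<close>

lemma hausdorff_premeasure_ge:
  fixes d :: "'a metric"
  assumes M: "compact_space (mtopology_of d)" and s: "0 < s"
    and finite_cover: "\<And>(J::nat set) E \<delta>. \<lbrakk>finite J; mspace d \<subseteq> (\<Union>j\<in>J. E j);
        \<And>j x y. \<lbrakk>j \<in> J; x \<in> E j; y \<in> E j\<rbrakk> \<Longrightarrow> mdist d x y \<le> \<delta> j; \<And>j. j \<in> J \<Longrightarrow> 0 < \<delta> j\<rbrakk>
      \<Longrightarrow> B \<le> (\<Sum>j\<in>J. \<delta> j powr s)"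
  shows "ennreal B \<le> hausdorff_premeasure d s \<epsilon> (mspace d)"
proof -
  interpret Metric_space "mspace d" "mdist d" by simp
  have mt: "mtopology_of d = mtopology" by (simp add: mtopology_of_def)
  show ?thesis unfolding hausdorff_premeasure_def
  proof (rule INF_greatest)
    fix E :: "nat \<Rightarrow> 'a set"
    assume "E \<in> {E. mspace d \<subseteq> (\<Union>i. E i) \<and> (\<forall>i. mbounded (E i) \<and> mdiameter d (E i) \<le> \<epsilon>)}"
    then have E: "mspace d \<subseteq> (\<Union>i. E i)" "\<And>i. mbounded (E i)" by auto
    define D where "D = (\<lambda>i. mdiameter d (E i))"
    have D: "mdist d x y \<le> D i" if "x \<in> E i" "y \<in> E i" for i x y
      unfolding D_def using mdist_le_mdiameter[OF E(2) that] .
    have dp: "diameter_power d s (E i) = D i powr s" for i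
      using s by (auto simp: diameter_power_def D_def mdiameter_def)
    show "ennreal B \<le> (\<Sum>i. ennreal (diameter_power d s (E i)))" unfolding dp
    proof (rule ennreal_le_epsilon)
      fix e :: real
      assume e: "0 < e"
      define e' where "e' = (\<lambda>i::nat. e * (1/2) ^ Suc i)"
      have e': "0 < e' i" for i using e by (simp add: e'_def)
      \<comment> \<open>Chosen so that the \<open>s\<close>-th power grows by exactly
        \<open>e' i\<close>. Also \<open>\<delta> i\<close> exceeds \<open>D i\<close>, and it is
        positive even where the diameter is zero.\<close>
      define \<delta> where "\<delta> = (\<lambda>i. (D i powr s + e' i) powr (1/s))"
      have pos: "0 < D i powr s + e' i" for i using e'[of i] by (simp add: add_nonneg_pos)
      have \<delta>: "\<delta> i powr s = D i powr s + e' i" for i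
        using pos[of i] s by (simp add: \<delta>_def powr_powr)
      have \<delta>0: "0 < \<delta> i" for i using pos[of i] by (simp add: \<delta>_def)
      have D\<delta>: "D i < \<delta> i" for i
      proof (rule ccontr)
        assume "\<not> D i < \<delta> i"
        then have "\<delta> i powr s \<le> D i powr s" using \<delta>0[of i] s by (intro powr_mono2) auto
        then show False using \<delta>[of i] e'[of i] by simp
      qed
      \<comment> \<open>The neighbourhood of radius half the difference raises distances from at
        most \<open>D i\<close> to at most \<open>\<delta> i\<close>.\<close>
      define G where "G = (\<lambda>i. \<Union>x\<in>E i. mball x ((\<delta> i - D i) / 2))"
      have G: "mdist d x y \<le> \<delta> i" if xy: "x \<in> G i" "y \<in> G i" for x y i
      proof -
        obtain u where u: "u \<in> E i" "u \<in> mspace d" "x \<in> mspace d" "mdist d u x < (\<delta> i - D i) / 2"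
          using xy(1) by (auto simp: G_def)
        obtain v where v: "v \<in> E i" "v \<in> mspace d" "y \<in> mspace d" "mdist d v y < (\<delta> i - D i) / 2"
          using xy(2) by (auto simp: G_def)
        have "mdist d x y \<le> mdist d u x + mdist d u v + mdist d v y"
          using triangle[OF u(3,2) v(3)] triangle[OF u(2) v(2,3)] commute[of x u] by linarith
        then show ?thesis using u v D[OF u(1) v(1)] by (simp add: field_simps)
      qed
      have "mspace d \<subseteq> (\<Union>i. G i)"
      proof
        fix x assume x: "x \<in> mspace d"
        then obtain i where "x \<in> E i" using E(1) by auto
        then have "x \<in> G i" using x D\<delta>[of i] by (auto simp: G_def intro!: bexI[of _ x])
        then show "x \<in> (\<Union>i. G i)" by blast
      qed
      moreover have "compactin mtopology (mspace d)" using M by (simp add: mt compact_space_def)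
      moreover have "openin mtopology U" if "U \<in> range G" for U using that by (auto simp: G_def)
      ultimately obtain F where F: "finite F" "F \<subseteq> range G" "mspace d \<subseteq> \<Union>F"
        using compactinD[of mtopology "mspace d" "range G"] by blast
      then obtain J where J: "finite J" "F = G ` J" by (meson finite_subset_image)
      have "B \<le> (\<Sum>j\<in>J. \<delta> j powr s)"
        by (rule finite_cover[of J G]) (use J F G \<delta>0 in auto)
      then have "ennreal B \<le> ennreal (\<Sum>j\<in>J. D j powr s + e' j)" unfolding \<delta> by (rule ennreal_leI)
      also have "\<dots> = (\<Sum>j\<in>J. ennreal (D j powr s) + ennreal (e' j))"
        using e' by (subst sum_ennreal[symmetric]) (auto simp: less_imp_le ennreal_plus)
      also have "\<dots> \<le> (\<Sum>j. ennreal (D j powr s) + ennreal (e' j))"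
        using J(1) by (intro sum_le_suminf) auto
      also have "\<dots> = (\<Sum>j. ennreal (D j powr s)) + (\<Sum>j. ennreal (e' j))"
        by (intro suminf_add[symmetric]) auto
      also have "(\<Sum>j. ennreal (e' j)) = ennreal e"
      proof (rule suminf_ennreal_eq)
        show "e' sums e" unfolding e'_def using sums_mult[OF power_half_series, of e] by simp
      qed (use e' in \<open>auto simp: less_imp_le\<close>)
      finally show "ennreal B \<le> (\<Sum>i. ennreal (D i powr s)) + ennreal e" .
    qed
  qed
qed

text \<open>With \<open>q\<close> solving \<open>(1 + \<kappa>/2) * \<kappa> powr q = 1\<close>, the
  bound holds for the exponent \<open>1 + q\<close>, since \<open>t powr q\<close> is least at
  \<open>t = \<kappa>\<close>. Smaller exponents only increase \<open>t powr s\<close> for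
  \<open>t \<le> 1\<close>.\<close>

lemma powr_exponent_above_one:
  fixes \<kappa> :: real
  assumes "0 < \<kappa>" "\<kappa> < 1"
  obtains s1 where "1 < s1" "\<And>s t. \<lbrakk>s \<le> s1; \<kappa> \<le> t; t \<le> 1\<rbrakk> \<Longrightarrow> t \<le> (1 + \<kappa>/2) * t powr s"
proof
  define q where "q = - ln (1 + \<kappa>/2) / ln \<kappa>"
  have "0 < ln (1 + \<kappa>/2)" "ln \<kappa> < 0" using assms by (auto intro: ln_gt_zero)
  then have q: "0 < q" by (simp add: q_def divide_pos_neg)
  then show "1 < 1 + q" by simp
  fix s t :: real assume s: "s \<le> 1 + q" and t: "\<kappa> \<le> t" "t \<le> 1"
  have "\<kappa> powr q = exp (- ln (1 + \<kappa>/2))" using assms by (simp add: powr_def q_def)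
  then have kq: "(1 + \<kappa>/2) * \<kappa> powr q = 1" using assms by (simp add: exp_minus)
  have "t = t * ((1 + \<kappa>/2) * \<kappa> powr q)" by (simp add: kq)
  also have "\<dots> \<le> t * ((1 + \<kappa>/2) * t powr q)"
    using assms t q by (intro mult_left_mono powr_mono2) auto
  also have "\<dots> = (1 + \<kappa>/2) * t powr (1 + q)" using assms t by (simp add: powr_add)
  also have "\<dots> \<le> (1 + \<kappa>/2) * t powr s" using assms t s by (intro mult_left_mono powr_mono') auto
  finally show "t \<le> (1 + \<kappa>/2) * t powr s" .
qed

lemma hausdorff_dimension_gt_1:
  fixes d :: "'a metric"
  assumes M: "compact_space (mtopology_of d)" "connected_space (mtopology_of d)"
    and xy: "x \<in> mspace d" "y \<in> mspace d" "x \<noteq> y"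
    and fork: "Metric_space.forked (mspace d) (mdist d) c r0" and c0: "0 < c" and r00: "0 < r0"
  shows "hausdorff_dimension d > 1"
proof -
  interpret Metric_space "mspace d" "mdist d" by simp
  have mt: "mtopology_of d = mtopology" by (simp add: mtopology_of_def)
  define c' where "c' = min c 1"
  \<comment> \<open>By the triangle inequality no point is closer than this to both \<open>x\<close>
    and \<open>y\<close>.\<close>
  define r where "r = min r0 (mdist d x y / 2)"
  have c': "0 < c'" "c' \<le> 1" using c0 by (auto simp: c'_def)
  have r: "0 < r" using r00 xy by (auto simp: r_def)
  have fork': "forked c' r"
    unfolding forked_def
  proof (intro ballI allI impI)
    fix p \<rho> x0 assume p: "p \<in> mspace d" "x0 \<in> mspace d" and \<rho>: "0 < \<rho> \<and> \<rho> \<le> r"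
    then obtain e q where "e \<in> mball p \<rho>" "q \<in> mball p \<rho>" "mdist d x0 e = mdist d x0 q" "c * \<rho> \<le> mdist d e q"
      using fork unfolding forked_def r_def by (meson min.boundedE)
    moreover have "c' * \<rho> \<le> c * \<rho>" using \<rho> by (intro mult_right_mono) (auto simp: c'_def)
    ultimately show "\<exists>e\<in>mball p \<rho>. \<exists>q\<in>mball p \<rho>. mdist d x0 e = mdist d x0 q \<and> c' * \<rho> \<le> mdist d e q"
      by (meson order_trans)
  qed
  have far: "\<exists>y\<in>mspace d. r \<le> mdist d z y" if z: "z \<in> mspace d" for z
  proof (rule ccontr)
    assume "\<not> ?thesis"
    then have "mdist d z x < r" "mdist d z y < r" using xy by (auto simp: not_le)
    then show False using triangle[OF xy(1) z xy(2)] commute[of x z] by (simp add: r_def)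
  qed
  define \<kappa> where "\<kappa> = c' / 160000"
  have \<kappa>: "0 < \<kappa>" "\<kappa> < 1" using c' by (auto simp: \<kappa>_def)
  obtain s1 where s1: "1 < s1" "\<And>s t. \<lbrakk>s \<le> s1; \<kappa> \<le> t; t \<le> 1\<rbrakk> \<Longrightarrow> t \<le> (1 + \<kappa>/2) * t powr s"
    using powr_exponent_above_one[OF \<kappa>] by blast
  have K: "spans (mspace d) x 0 r"
    using far[OF xy(1)] xy(1) r M unfolding spans_def mt
    by (metis compact_space_def connectedin_topspace topspace_mtopology mdist_zero)
  have pos: "hausdorff_measure d s (mspace d) \<noteq> 0" if s: "0 < s" "s \<le> s1" for s
  proof -
    have "ennreal ((\<kappa> / 32 * r) powr s) \<le> hausdorff_premeasure d s 1 (mspace d)"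
    proof (rule hausdorff_premeasure_ge[OF M(1) s(1)])
      fix J :: "nat set" and E \<delta>
      assume J: "finite J" "mspace d \<subseteq> (\<Union>j\<in>J. E j)"
        and E: "\<And>j x y. \<lbrakk>j \<in> J; x \<in> E j; y \<in> E j\<rbrakk> \<Longrightarrow> mdist d x y \<le> \<delta> j" and \<delta>: "\<And>j. j \<in> J \<Longrightarrow> 0 < \<delta> j"
      \<comment> \<open>The inserted 1 keeps the minimum defined for empty \<open>J\<close>.\<close>
      define \<epsilon> where "\<epsilon> = Min (insert 1 (\<delta> ` J))"
      have \<epsilon>: "0 < \<epsilon>" "\<And>j. j \<in> J \<Longrightarrow> \<epsilon> \<le> \<delta> j" using J(1) \<delta> by (auto simp: \<epsilon>_def)
      obtain n where "r / \<epsilon> < (4/3) ^ n" using real_arch_pow[of "4/3" "r / \<epsilon>"] by auto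
      then have n: "r - 0 \<le> (4/3) ^ n * \<epsilon>" using \<epsilon>(1) by (simp add: field_simps)
      have "(\<kappa> / 32 * (r - 0)) powr s \<le> (\<Sum>j\<in>{j\<in>J. E j \<inter> slab (mspace d) x 0 r \<noteq> {}}. \<delta> j powr s)"
        by (rule cover_sum_ge[OF fork' c' far M[unfolded mt] \<kappa>_def s(1) _ J E \<epsilon> K _ n])
          (use s1(2)[OF s(2)] in auto)
      also have "\<dots> \<le> (\<Sum>j\<in>J. \<delta> j powr s)" using J(1) by (intro sum_mono2) auto
      finally show "(\<kappa> / 32 * r) powr s \<le> (\<Sum>j\<in>J. \<delta> j powr s)" by simp
    qed
    also have "\<dots> \<le> hausdorff_measure d s (mspace d)"
      unfolding hausdorff_measure_def by (rule SUP_upper) simp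
    finally show ?thesis using \<kappa> r by (auto simp: ennreal_eq_0_iff)
  qed
  \<comment> \<open>The exponent 0 is separate: \<open>diameter_power\<close> then counts nonempty
    sets, and a cover of a nonempty space contains one.\<close>
  have pos0: "hausdorff_measure d 0 (mspace d) \<noteq> 0"
  proof -
    have "1 \<le> hausdorff_premeasure d 0 1 (mspace d)"
      unfolding hausdorff_premeasure_def
    proof (rule INF_greatest)
      fix E :: "nat \<Rightarrow> 'a set"
      assume "E \<in> {E. mspace d \<subseteq> (\<Union>i. E i) \<and> (\<forall>i. mbounded (E i) \<and> mdiameter d (E i) \<le> 1)}"
      then obtain i where "E i \<noteq> {}" using xy(1) by blast
      then have "(\<Sum>i\<in>{i}. ennreal (diameter_power d 0 (E i))) = 1" by (simp add: diameter_power_def)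
      then show "1 \<le> (\<Sum>i. ennreal (diameter_power d 0 (E i)))"
        using sum_le_suminf[of "\<lambda>i. ennreal (diameter_power d 0 (E i))" "{i}"] by simp
    qed
    also have "\<dots> \<le> hausdorff_measure d 0 (mspace d)"
      unfolding hausdorff_measure_def by (rule SUP_upper) simp
    finally show ?thesis by auto
  qed
  have "ennreal s1 \<le> hausdorff_dimension d"
    unfolding hausdorff_dimension_def
  proof (rule Inf_greatest)
    fix v assume "v \<in> {ennreal s |s. 0 \<le> s \<and> hausdorff_measure d s (mspace d) = 0}"
    then obtain s where s: "v = ennreal s" "0 \<le> s" "hausdorff_measure d s (mspace d) = 0" by auto
    then have "s1 \<le> s" using pos[of s] pos0 by (cases "s = 0") force+
    then show "ennreal s1 \<le> v" using s by (simp add: ennreal_leI)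
  qed
  moreover have "1 < ennreal s1" using s1(1) by (simp add: ennreal_1[symmetric] ennreal_less_iff del: ennreal_1)
  ultimately show ?thesis by (rule order.strict_trans2[rotated])
qed

section \<open>Lifting through finite branched coverings\<close>

lemma local_degree_ge_1:
  assumes fin: "\<And>z. z \<in> topspace Z \<Longrightarrow> finite {x \<in> topspace X. f x = z}"
    and f: "continuous_map X Z f" and "x \<in> topspace X"
  shows "1 \<le> local_degree X f x"
  unfolding local_degree_def
proof (rule INF_greatest)
  fix U assume "U \<in> {U. neighbourhood_of X U x}"
  then have U: "U \<subseteq> topspace X" "x \<in> U"
    by (auto simp: neighbourhood_of_def dest: subsetD[OF interior_of_subset])
  have "f x \<in> topspace Z" using f assms(3) by (auto simp: continuous_map_def)
  then have "finite {y \<in> U. f y = f x}" using fin U(1) by (auto intro: finite_subset[rotated])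
  moreover have "x \<in> {y \<in> U. f y = f x}" using U by auto
  ultimately have "0 < card {y \<in> U. f y = f x}" using card_gt_0_iff by blast
  then have "(1::enat) \<le> enat (card {y \<in> U. f y = f x})" by (simp add: one_enat_def)
  also have "\<dots> \<le> map_degree f U (f ` U)"
    unfolding map_degree_def using U by (intro SUP_upper) auto
  finally show "1 \<le> map_degree f U (f ` U)" .
qed

lemma finite_branched_covering_imp_open_map:
  assumes "finite_branched_covering X Z f"
  shows "open_map X Z f"
proof -
  have X: "compact_space X" "Hausdorff_space X" "Hausdorff_space Z" and f: "continuous_map X Z f"
    and fin: "\<And>z. z \<in> topspace Z \<Longrightarrow> finite {x \<in> topspace X. f x = z}"
    and deg: "map_degree f (topspace X) (topspace Z) < \<infinity>"
    and loc: "\<And>x0. x0 \<in> topspace X \<Longrightarrow> \<exists>U V. compactin X U \<and> neighbourhood_of X U x0 \<and>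
        compactin Z V \<and> neighbourhood_of Z V (f x0) \<and>
        (\<forall>z\<in>V. (\<Sum>x\<in>{x \<in> U. f x = z}. local_degree X f x) = local_degree X f x0)"
    using assms unfolding finite_branched_covering_def by blast+
  have fX: "f x \<in> topspace Z" if "x \<in> topspace X" for x using f that by (auto simp: continuous_map_def)
  have ge1: "1 \<le> local_degree X f x" if "x \<in> topspace X" for x
    by (rule local_degree_ge_1[OF fin f that])
  \<comment> \<open>Finiteness is what permits cancelling the term of \<open>x0\<close> from a sum
    of extended naturals.\<close>
  have ldfin: "local_degree X f x \<noteq> \<infinity>" if "x \<in> topspace X" for x
  proof -
    have "local_degree X f x \<le> map_degree f (topspace X) (f ` topspace X)"
      unfolding local_degree_def using that by (intro INF_lower) (auto simp: neighbourhood_of_def)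
    also have "\<dots> \<le> map_degree f (topspace X) (topspace Z)"
      unfolding map_degree_def using fX by (intro SUP_subset_mono) auto
    finally have "local_degree X f x < \<infinity>" using deg by (rule le_less_trans)
    then show ?thesis by simp
  qed
  show ?thesis unfolding open_map_def
  proof (intro allI impI)
    fix W assume W: "openin X W"
    show "openin Z (f ` W)"
    proof (subst openin_subopen, intro ballI)
      fix y assume "y \<in> f ` W"
      then obtain x0 where x0: "x0 \<in> W" "y = f x0" by auto
      have x0X: "x0 \<in> topspace X" using x0 W openin_subset by blast
      obtain U V where U: "compactin X U" "neighbourhood_of X U x0"
        and V: "compactin Z V" "neighbourhood_of Z V (f x0)"
        and sum: "\<And>z. z \<in> V \<Longrightarrow> (\<Sum>x\<in>{x \<in> U. f x = z}. local_degree X f x) = local_degree X f x0"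
        using loc[OF x0X] by blast
      have UX: "U \<subseteq> topspace X" "x0 \<in> U" and VZ: "V \<subseteq> topspace Z" "f x0 \<in> V"
        using U V by (auto simp: neighbourhood_of_def dest: subsetD[OF interior_of_subset])
      let ?S = "{x \<in> U. f x = f x0}"
      have finS: "finite ?S" using fin[OF fX[OF x0X]] UX by (auto intro: finite_subset[rotated])
      have "local_degree X f x0 + (\<Sum>x\<in>?S - {x0}. local_degree X f x) = local_degree X f x0 + 0"
        using sum[OF VZ(2)] finS UX by (simp add: sum.remove[of ?S x0])
      then have "(\<Sum>x\<in>?S - {x0}. local_degree X f x) = 0"
        using ldfin[OF x0X] by (metis enat_add_left_cancel)
      then have "\<forall>x\<in>?S - {x0}. local_degree X f x = 0" using finS by (simp add: sum_eq_0_iff)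
      moreover have "local_degree X f x \<noteq> 0" if "x \<in> U" for x using ge1[of x] UX that by auto
      ultimately have uniq: "x = x0" if "x \<in> U" "f x = f x0" for x using that by blast
      define K where "K = U - W"
      have "compactin X K" unfolding K_def
        using U(1) W X by (meson closedin_diff compactin_imp_closedin closed_compactin Diff_subset openin_closedin_eq)
      then have "closedin Z (f ` K)" using f X by (meson compactin_imp_closedin image_compactin)
      then have "openin Z (Z interior_of V - f ` K)" by (simp add: openin_diff)
      moreover have "y \<in> Z interior_of V - f ` K" using V(2) uniq x0 by (auto simp: neighbourhood_of_def K_def)
      moreover have "Z interior_of V - f ` K \<subseteq> f ` W"
      proof
        fix z assume z: "z \<in> Z interior_of V - f ` K"
        then have "z \<in> V" by (auto dest: subsetD[OF interior_of_subset])
        have "{x \<in> U. f x = z} \<noteq> {}"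
        proof
          assume "{x \<in> U. f x = z} = {}"
          then have "local_degree X f x0 = 0" using sum[OF \<open>z \<in> V\<close>] by (metis sum.empty)
          then show False using ge1[OF x0X] by simp
        qed
        then show "z \<in> f ` W" using z by (auto simp: K_def)
      qed
      ultimately show "\<exists>T. openin Z T \<and> y \<in> T \<and> T \<subseteq> f ` W" by blast
    qed
  qed
qed

text \<open>The component is open by local connectedness. Its image is open because \<open>f\<close>
  is an open map and relatively closed by compactness, hence it is all of the connected set
  \<open>V\<close>.\<close>

lemma component_of_preimage:
  assumes X: "compact_space X" "Hausdorff_space X" "locally_connected_space X"
    and f: "continuous_map X X f" "open_map X X f"
    and V: "openin X V" "connectedin X V"
    and C: "C \<in> connected_components_of (subtopology X {x \<in> topspace X. f x \<in> V})"
  shows "openin X C" "connectedin X C" "f ` C = V"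
    "\<And>D. \<lbrakk>connectedin X D; D \<inter> C \<noteq> {}; f ` D \<subseteq> V\<rbrakk> \<Longrightarrow> D \<subseteq> C"
proof -
  let ?P = "{x \<in> topspace X. f x \<in> V}"
  have P: "openin X ?P" by (rule openin_continuous_map_preimage[OF f(1) V(1)])
  have CP: "C \<subseteq> ?P" "C \<noteq> {}" using connected_components_of_subset[OF C] nonempty_connected_components_of[OF C] by auto
  have "openin (subtopology X ?P) C"
    using openin_connected_components_of_locally_connected_space[OF locally_connected_space_open_subset[OF X(3) P] C] .
  then show oC: "openin X C" using P openin_trans_full by blast
  show cC: "connectedin X C" using connectedin_connected_components_of[OF C] by (simp add: connectedin_subtopology)
  show max: "D \<subseteq> C" if D: "connectedin X D" "D \<inter> C \<noteq> {}" "f ` D \<subseteq> V" for D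
  proof -
    have "connectedin (subtopology X ?P) D"
      using D connectedin_subset_topspace[OF D(1)] by (auto simp: connectedin_subtopology)
    then show ?thesis using connected_components_of_maximal[OF C] D(2) by (auto simp: disjnt_def)
  qed
  \<comment> \<open>\<open>C\<close> is closed only relative to the preimage of \<open>V\<close>, so
    closedness of its image is obtained from a set \<open>T\<close> that is closed, hence compact,
    in \<open>X\<close>.\<close>
  have "closedin (subtopology X ?P) C" using C by (rule closedin_connected_components_of)
  then obtain T where T: "closedin X T" "C = T \<inter> ?P" by (auto simp: closedin_subtopology)
  have "closedin X (f ` T)"
    using T X f by (meson closedin_compact_space compactin_imp_closedin image_compactin)
  moreover have "f ` C = V \<inter> f ` T"
    using T(2) CP closedin_subset[OF T(1)] by auto
  ultimately have "closedin (subtopology X V) (f ` C)"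
    by (auto simp: closedin_subtopology)
  moreover have "openin X (f ` C)" using f(2) oC by (simp add: open_map_def)
  then have "openin (subtopology X V) (f ` C)"
    using CP by (auto simp: openin_subtopology)
  moreover have "connected_space (subtopology X V)" using V(2) by (simp add: connectedin_def)
  moreover have "topspace (subtopology X V) = V" using openin_subset[OF V(1)] by auto
  ultimately show "f ` C = V" using CP(2) by (metis connected_space_clopen_in image_is_empty)
qed

section \<open>The pullback covers of a cxc system: images, lifts, finiteness and smallness\<close>

locale cxc =
  fixes X :: "'a topology" and f :: "'a \<Rightarrow> 'a" and \<U> :: "'a set set"
  assumes cxc: "topological_cxc_wrt X f \<U>"
begin

abbreviation "cover \<equiv> pullback_cover X f \<U>"

lemma space: "compact_space X" "connected_space X" "locally_connected_space X" "Hausdorff_space X"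
  and cont: "continuous_map X X f" and open_map: "open_map X X f"
  and finite_fibres: "z \<in> topspace X \<Longrightarrow> finite {x \<in> topspace X. f x = z}"
  and U0: "finite \<U>" "U \<in> \<U> \<Longrightarrow> U \<noteq> {} \<and> openin X U \<and> connectedin X U" "\<Union>\<U> = topspace X"
  and expansion: "expansion_axiom X f \<U>" and irreducible: "irreducibility_axiom X f"
  using cxc finite_branched_covering_imp_open_map[of X X f]
  by (auto simp: topological_cxc_wrt_def finite_branched_covering_def)

lemma nontrivial: "\<exists>x\<in>topspace X. \<exists>y\<in>topspace X. x \<noteq> y"
  using cxc by (simp add: topological_cxc_wrt_def)

lemma f_topspace: "x \<in> topspace X \<Longrightarrow> f x \<in> topspace X"
  using cont by (auto simp: continuous_map_def)

lemma cont_funpow: "continuous_map X X (f ^^ k)"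
proof (induction k)
  case (Suc k)
  then show ?case unfolding funpow.simps(2) by (rule continuous_map_compose[OF _ cont])
qed (simp add: id_def)

lemma funpow_topspace: "x \<in> topspace X \<Longrightarrow> (f ^^ k) x \<in> topspace X"
  by (induction k) (auto simp: f_topspace)

lemma cover_open_connected: "U \<in> cover n \<Longrightarrow> U \<noteq> {} \<and> openin X U \<and> connectedin X U"
proof (induction n arbitrary: U)
  case (Suc n)
  then obtain V where V: "V \<in> cover n" "U \<in> connected_components_of (subtopology X {x \<in> topspace X. f x \<in> V})"
    by auto
  then have "openin X V" "connectedin X V" using Suc.IH by auto
  from component_of_preimage(1,2)[OF space(1,4,3) cont open_map this V(2)] show ?case
    using nonempty_connected_components_of[OF V(2)] by auto
qed (use U0 in auto)

lemma cover_Suc_cases: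
  assumes "U \<in> cover (Suc n)"
  shows "f ` U \<in> cover n"
    and "\<And>D. \<lbrakk>connectedin X D; D \<inter> U \<noteq> {}; f ` D \<subseteq> f ` U\<rbrakk> \<Longrightarrow> D \<subseteq> U"
proof -
  obtain V where V: "V \<in> cover n" "U \<in> connected_components_of (subtopology X {x \<in> topspace X. f x \<in> V})"
    using assms by auto
  note c = component_of_preimage[OF space(1,4,3) cont open_map _ _ V(2)]
  have o: "openin X V" "connectedin X V" using cover_open_connected[OF V(1)] by auto
  show "f ` U \<in> cover n" using c(3)[OF o] V(1) by simp
  show "D \<subseteq> U" if "connectedin X D" "D \<inter> U \<noteq> {}" "f ` D \<subseteq> f ` U" for D
    using c(4)[OF o that(1,2)] that(3) c(3)[OF o] by simp
qed

lemma cover_image: "U \<in> cover (n + k) \<Longrightarrow> (f ^^ k) ` U \<in> cover n"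
proof (induction k arbitrary: U)
  case (Suc k)
  then have "(f ^^ k) ` (f ` U) \<in> cover n" using cover_Suc_cases(1)[of U "n + k"] by simp
  then show ?case by (simp add: image_image funpow_swap1)
qed simp

text \<open>One step is the maximality of components; the induction pushes \<open>U\<close> and
  \<open>D\<close> forward by \<open>f\<close>. This is how lifted sets are located inside a given
  cover element.\<close>

lemma cover_maximal:
  "\<lbrakk>U \<in> cover (n + k); connectedin X D; D \<inter> U \<noteq> {}; (f ^^ k) ` D \<subseteq> (f ^^ k) ` U\<rbrakk> \<Longrightarrow> D \<subseteq> U"
proof (induction k arbitrary: U D)
  case (Suc k)
  have U: "U \<in> cover (Suc (n + k))" using Suc.prems(1) by simp
  have "f ` D \<subseteq> f ` U"
  proof (rule Suc.IH)
    show "f ` U \<in> cover (n + k)" using cover_Suc_cases(1)[OF U] .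
    show "connectedin X (f ` D)" using Suc.prems(2) cont connectedin_continuous_map_image by blast
    show "f ` D \<inter> f ` U \<noteq> {}" using Suc.prems(3) by blast
    show "(f ^^ k) ` f ` D \<subseteq> (f ^^ k) ` f ` U"
      using Suc.prems(4) by (simp add: image_image funpow_swap1)
  qed
  then show ?case using cover_Suc_cases(2)[OF U] Suc.prems by blast
qed simp

text \<open>Components of preimages are taken one step at a time along the orbit of
  \<open>x\<close>. The level \<open>n\<close> is quantified inside, as the lift does not depend on
  it and \<open>V\<close> may belong to several covers.\<close>

lemma lift_open_connected:
  assumes "openin X V" "connectedin X V" "x \<in> topspace X" "(f ^^ k) x \<in> V"
  shows "\<exists>W. openin X W \<and> connectedin X W \<and> x \<in> W \<and> (f ^^ k) ` W = V \<and> (\<forall>n. V \<in> cover n \<longrightarrow> W \<in> cover (n + k))"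
  using assms
proof (induction k arbitrary: x)
  case (Suc k)
  have "(f ^^ k) (f x) \<in> V" using Suc.prems(4) by (simp add: funpow_swap1)
  with Suc.IH[OF Suc.prems(1,2) f_topspace[OF Suc.prems(3)]]
  obtain W where W: "openin X W" "connectedin X W" "f x \<in> W" "(f ^^ k) ` W = V" "\<And>n. V \<in> cover n \<Longrightarrow> W \<in> cover (n + k)"
    by blast
  let ?Y = "subtopology X {x \<in> topspace X. f x \<in> W}"
  define C where "C = connected_component_of_set ?Y x"
  have xY: "x \<in> topspace ?Y" using Suc.prems(3) W(3) by auto
  then have C: "C \<in> connected_components_of ?Y"
    by (simp add: C_def connected_component_in_connected_components_of)
  note c = component_of_preimage[OF space(1,4,3) cont open_map W(1,2) C]
  have "(f ^^ Suc k) ` C = V" using c(3) W(4) by (metis funpow_Suc_right image_comp)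
  moreover have "x \<in> C" using xY by (simp add: C_def connected_component_of_refl)
  moreover have "C \<in> cover (n + Suc k)" if "V \<in> cover n" for n using W(5)[OF that] C by auto
  ultimately show ?case using c(1,2) by blast
qed auto

lemma cover_covers: "x \<in> topspace X \<Longrightarrow> \<exists>U\<in>cover n. x \<in> U"
proof -
  assume x: "x \<in> topspace X"
  then obtain V where V: "V \<in> \<U>" "(f ^^ n) x \<in> V" using funpow_topspace U0(3) by blast
  then have "V \<in> cover 0" by simp
  with lift_open_connected[of V x n] V x U0(2) show ?thesis by (metis add_0)
qed

text \<open>Every component over \<open>V\<close> maps onto \<open>V\<close>, so it contains a point
  of the finite fibre over a fixed \<open>v \<in> V\<close>.\<close>

lemma finite_cover: "finite (cover n)"
proof (induction n)
  case (Suc n)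
  have "finite (connected_components_of (subtopology X {x \<in> topspace X. f x \<in> V}))" if V: "V \<in> cover n" for V
  proof -
    let ?Y = "subtopology X {x \<in> topspace X. f x \<in> V}"
    have o: "openin X V" "connectedin X V" "V \<noteq> {}" using cover_open_connected[OF V] by auto
    then obtain v where v: "v \<in> V" "v \<in> topspace X" using openin_subset by blast
    have "C \<in> connected_component_of_set ?Y ` {x \<in> topspace X. f x = v}" if C: "C \<in> connected_components_of ?Y" for C
    proof -
      have "f ` C = V" using component_of_preimage(3)[OF space(1,4,3) cont open_map o(1,2) C] .
      then obtain x where x: "x \<in> C" "f x = v" using v by auto
      have "x \<in> topspace X" using x connected_components_of_subset[OF C] by auto
      moreover have "C = connected_component_of_set ?Y x"
        using C x(1) unfolding connected_components_of_def by (auto simp: connected_component_of_equiv)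
      ultimately show ?thesis using x by blast
    qed
    then show ?thesis using finite_fibres[OF v(2)] by (meson finite_imageI finite_subset subsetI)
  qed
  then show ?case using Suc by simp
qed (use U0 in auto)

text \<open>Expansion is applied to the open cover by \<open>W\<close> and the complement of
  \<open>x\<close>; an element that contains \<open>x\<close> cannot lie in the latter.\<close>

lemma cover_small:
  assumes "openin X W" "x \<in> W"
  obtains N where "\<And>n U. \<lbrakk>N < n; U \<in> cover n; x \<in> U\<rbrakk> \<Longrightarrow> U \<subseteq> W"
proof -
  have "closedin X {x}" using assms space(4) openin_subset by (metis closedin_Hausdorff_sing_eq subsetD)
  then have "\<forall>V\<in>{W, topspace X - {x}}. openin X V" using assms by auto
  moreover have "\<Union>{W, topspace X - {x}} = topspace X" using assms openin_subset[OF assms(1)] by auto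
  ultimately obtain N where "\<forall>n>N. \<forall>U\<in>cover n. \<exists>V\<in>{W, topspace X - {x}}. U \<subseteq> V"
    using expansion unfolding expansion_axiom_def by presburger
  then show thesis using that[of N] by blast
qed

end

section \<open>Triods\<close>

text \<open>A weak, open form of a tripod: the legs are open connected sets that may overlap away
  from the ends, and only a neighbourhood of each end must miss the other legs. In this form it
  lifts through the open map \<open>f\<close>, where arcs might not.\<close>

definition triod :: "'a topology \<Rightarrow> 'a set \<Rightarrow> 'a \<Rightarrow> (nat \<Rightarrow> 'a set) \<Rightarrow> (nat \<Rightarrow> 'a) \<Rightarrow> (nat \<Rightarrow> 'a set) \<Rightarrow> bool" where
  "triod X W p L e G \<longleftrightarrow>
     (\<forall>i<3. openin X (L i) \<and> connectedin X (L i) \<and> p \<in> L i \<and> L i \<subseteq> W \<and> e i \<in> L i \<and> openin X (G i) \<and> e i \<in> G i) \<and>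
     (\<forall>i<3. \<forall>j<3. i \<noteq> j \<longrightarrow> G i \<inter> L j = {})"

lemma triod_of_legs:
  assumes X: "compact_space X" "Hausdorff_space X" "locally_connected_space X" and V: "openin X V"
    and K: "\<And>i::nat. i < 3 \<Longrightarrow> compactin X (K i) \<and> connectedin X (K i) \<and> p \<in> K i \<and> K i \<subseteq> V \<and> e i \<in> K i"
    and e: "\<And>i j. \<lbrakk>i < 3; j < 3; i \<noteq> j\<rbrakk> \<Longrightarrow> e i \<notin> K j"
  shows "\<exists>L G. triod X V p L e G"
proof -
  have "\<exists>G H. openin X G \<and> openin X H \<and> e i \<in> G \<and> (\<Union>j\<in>{..<3}-{i}. K j) \<subseteq> H \<and> disjnt G H" if i: "i < 3" for i
  proof -
    have "compactin X (\<Union>j\<in>{..<3}-{i}. K j)" using K by (intro compactin_Union) auto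
    moreover have "compactin X {e i}" using K[OF i] connectedin_subset_topspace by (auto simp: compactin_sing)
    moreover have "disjnt {e i} (\<Union>j\<in>{..<3}-{i}. K j)" using e[OF i] by auto
    ultimately show ?thesis using X(2) Hausdorff_space_compact_separation by (metis insert_subset)
  qed
  then obtain G H where GH: "\<And>i. i < 3 \<Longrightarrow> openin X (G i) \<and> openin X (H i) \<and> e i \<in> G i \<and>
      (\<Union>j\<in>{..<3}-{i}. K j) \<subseteq> H i \<and> disjnt (G i) (H i)"
    by metis
  define W where "W = (\<lambda>i. V \<inter> (\<Inter>j\<in>{..<3}-{i}. H j))"
  have W: "openin X (W i)" if "i < 3" for i
  proof -
    \<comment> \<open>The intersection over the other two indices is over a nonempty family.\<close>
    have "(if i = 0 then 1 else 0) \<in> {..<3} - {i}" by auto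
    then have "{..<3} - {i} \<noteq> {}" by blast
    then show ?thesis unfolding W_def using V GH by (intro openin_Int openin_INT2) auto
  qed
  have KW: "K i \<subseteq> W i" if "i < 3" for i
    using K[OF that] GH that unfolding W_def by blast
  define L where "L = (\<lambda>i. connected_component_of_set (subtopology X (W i)) p)"
  have LW: "L i \<subseteq> W i" for i
    unfolding L_def using connected_component_of_subset_topspace[of "subtopology X (W i)" p] by auto
  have oL: "openin X (L i)" if "i < 3" for i
  proof -
    have "openin (subtopology X (W i)) (L i)"
      unfolding L_def
      by (rule openin_connected_component_of_locally_connected_space[OF locally_connected_space_open_subset[OF X(3) W[OF that]]])
    then show ?thesis using W[OF that] by (rule openin_trans_full)
  qed
  have cL: "connectedin X (L i)" for i
    using connectedin_connected_component_of[of "subtopology X (W i)" p]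
    unfolding L_def connectedin_subtopology by blast
  have KL: "K i \<subseteq> L i" if "i < 3" for i
    unfolding L_def using K[OF that] KW[OF that]
    by (intro connected_component_of_maximal) (auto simp: connectedin_subtopology)
  have GL: "G i \<inter> L j = {}" if "i < 3" "j < 3" "i \<noteq> j" for i j
  proof -
    have "L j \<subseteq> H i" using LW[of j] that unfolding W_def by blast
    then show ?thesis using GH[OF that(1)] by (auto simp: disjnt_iff)
  qed
  have "openin X (L i) \<and> connectedin X (L i) \<and> p \<in> L i \<and> L i \<subseteq> V \<and> e i \<in> L i \<and> openin X (G i) \<and> e i \<in> G i"
    if i: "i < 3" for i
    using GH[OF i] oL[OF i] cL[of i] subsetD[OF KL[OF i]] K[OF i] LW[of i] by (simp add: W_def)
  then have "triod X V p L e G" unfolding triod_def using GL by simp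
  then show ?thesis by blast
qed

text \<open>Shortening the three segments to a common length \<open>t\<close> puts their images into
  any given neighbourhood of the branch point; injectivity keeps each end off the other
  legs.\<close>

lemma local_triods_if_tripod:
  assumes X: "compact_space X" "Hausdorff_space X" "locally_connected_space X"
    and S: "S \<subseteq> topspace X" "subtopology X S homeomorphic_space top_of_set tripod"
  shows "\<exists>p\<in>topspace X. \<forall>V. openin X V \<and> p \<in> V \<longrightarrow> (\<exists>L e G. triod X V p L e G)"
proof -
  obtain g where "homeomorphic_map (top_of_set tripod) (subtopology X S) g"
    using S(2) homeomorphic_space homeomorphic_space_sym by metis
  then have cg: "continuous_map (top_of_set tripod) (subtopology X S) g" and ig: "inj_on g tripod"
    using homeomorphic_imp_continuous_map homeomorphic_imp_injective_map by fastforce+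
  then have cgX: "continuous_map (top_of_set tripod) X g"
    using continuous_map_in_subtopology by blast
  define v where "v = (\<lambda>i::nat. axis (if i = 0 then 1 else if i = 1 then 2 else 3) (1::real) :: real^3)"
  have seg: "closed_segment 0 (v i) \<subseteq> tripod" for i by (auto simp: tripod_def v_def)
  have nv: "norm (v i) = 1" for i by (simp add: v_def)
  have seg_eq: "closed_segment 0 (v i) = (\<lambda>u. u *\<^sub>R v i) ` {0..1}" for i
    by (auto simp: closed_segment_def)
  have sub: "t *\<^sub>R v i \<in> tripod" if "0 \<le> t" "t \<le> 1" for t i
    using that by (intro subsetD[OF seg[of i, unfolded seg_eq] imageI]) simp
  have z: "0 \<in> tripod" using sub[of 0 0] by simp
  have vneq: "t *\<^sub>R v i \<noteq> s *\<^sub>R v j" if "i < 3" "j < 3" "i \<noteq> j" "0 < t" for t s i j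
  proof
    define k where "k = (if i = 0 then 1 else if i = 1 then 2 else 3 :: 3)"
    assume "t *\<^sub>R v i = s *\<^sub>R v j"
    then have "(t *\<^sub>R v i) $ k = (s *\<^sub>R v j) $ k" by simp
    moreover have "(t *\<^sub>R v i) $ k = t" by (simp add: v_def k_def axis_def)
    moreover have "i = 0 \<or> i = 1 \<or> i = 2" "j = 0 \<or> j = 1 \<or> j = 2" using that by auto
    then have "(s *\<^sub>R v j) $ k = 0" using that(3) by (elim disjE) (simp_all add: v_def k_def axis_def)
    ultimately show False using that by simp
  qed
  have "\<exists>L e G. triod X V (g 0) L e G" if V: "openin X V" "g 0 \<in> V" for V
  proof -
    have "openin (top_of_set tripod) {x \<in> topspace (top_of_set tripod). g x \<in> V}"
      by (rule openin_continuous_map_preimage[OF cgX V(1)])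
    then have "openin (top_of_set tripod) {x \<in> tripod. g x \<in> V}" by simp
    moreover have "0 \<in> {x \<in> tripod. g x \<in> V}" using V(2) z by simp
    ultimately obtain \<epsilon> where "0 < \<epsilon>" "\<forall>x\<in>tripod. dist x 0 < \<epsilon> \<longrightarrow> x \<in> {x \<in> tripod. g x \<in> V}"
      unfolding openin_euclidean_subtopology_iff by meson
    then have \<epsilon>: "0 < \<epsilon>" "\<And>x. x \<in> tripod \<Longrightarrow> dist x 0 < \<epsilon> \<Longrightarrow> g x \<in> V" by simp_all
    define t where "t = min 1 (\<epsilon> / 2)"
    have t: "0 < t" "t \<le> 1" "t < \<epsilon>" using \<epsilon>(1) by (auto simp: t_def)
    define K where "K = (\<lambda>i. g ` ((\<lambda>u. u *\<^sub>R v i) ` {0..t}))"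
    define e where "e = (\<lambda>i. g (t *\<^sub>R v i))"
    have s1: "(\<lambda>u. u *\<^sub>R v i) ` {0..t} \<subseteq> tripod" for i using sub t by auto
    have cpt: "compact ((\<lambda>u. u *\<^sub>R v i) ` {0..t})" "connected ((\<lambda>u. u *\<^sub>R v i) ` {0..t})" for i
      by (intro compact_continuous_image connected_continuous_image continuous_intros; simp)+
    have cK: "compactin X (K i)" for i
      unfolding K_def by (rule image_compactin[OF _ cgX]) (use s1 cpt in \<open>simp add: compactin_subtopology\<close>)
    have nK: "connectedin X (K i)" for i
      unfolding K_def by (rule connectedin_continuous_map_image[OF cgX]) (use s1 cpt in \<open>simp add: connectedin_subtopology\<close>)
    have "\<exists>L G. triod X V (g 0) L e G"
    proof (rule triod_of_legs[OF X V(1), of K])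
      fix i :: nat assume "i < 3"
      have "g 0 \<in> K i" unfolding K_def using t by (intro image_eqI[of _ _ 0] image_eqI[of _ _ "0::real"]) auto
      moreover have "e i \<in> K i" unfolding K_def e_def using t by (intro imageI) auto
      moreover have "K i \<subseteq> V"
      proof
        fix y assume "y \<in> K i"
        then obtain u where u: "0 \<le> u" "u \<le> t" "y = g (u *\<^sub>R v i)" by (auto simp: K_def)
        have "dist (u *\<^sub>R v i) 0 < \<epsilon>" using u t nv by simp
        then show "y \<in> V" using \<epsilon>(2) sub[of u i] u t by auto
      qed
      ultimately show "compactin X (K i) \<and> connectedin X (K i) \<and> g 0 \<in> K i \<and> K i \<subseteq> V \<and> e i \<in> K i"
        using cK nK by blast
    next
      fix i j :: nat assume ij: "i < 3" "j < 3" "i \<noteq> j"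
      show "e i \<notin> K j"
      proof
        assume "e i \<in> K j"
        then obtain u where u: "0 \<le> u" "u \<le> t" "g (t *\<^sub>R v i) = g (u *\<^sub>R v j)" by (auto simp: K_def e_def)
        then have "t *\<^sub>R v i = u *\<^sub>R v j" using ig sub[of t i] sub[of u j] t by (auto simp: inj_on_def)
        then show False using vneq[OF ij t(1)] by blast
      qed
    qed
    then show ?thesis by blast
  qed
  moreover have "g 0 \<in> topspace X" using cgX z by (auto simp: continuous_map_def)
  ultimately show ?thesis by blast
qed

section \<open>Transporting triods by the dynamics\<close>

context cxc
begin

text \<open>Each leg is lifted separately through \<open>q\<close>, and \<open>cover_maximal\<close>
  keeps it in \<open>W\<close>. The preimage of \<open>G i\<close> misses the other lifted legs
  because these map onto the original ones.\<close>

lemma lift_triod: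
  assumes T: "triod X V p L e G" and W: "W \<in> cover (n + k)" "(f ^^ k) ` W = V"
    and q: "q \<in> W" "(f ^^ k) q = p"
  shows "\<exists>L' e'. triod X W q L' e' (\<lambda>i. {x \<in> topspace X. (f ^^ k) x \<in> G i}) \<and>
    (\<forall>i<3. (f ^^ k) ` L' i = L i \<and> (f ^^ k) (e' i) = e i)"
proof -
  have qX: "q \<in> topspace X" using q cover_open_connected[OF W(1)] openin_subset by blast
  have "\<exists>M a. openin X M \<and> connectedin X M \<and> q \<in> M \<and> (f ^^ k) ` M = L i \<and> a \<in> M \<and> (f ^^ k) a = e i" if "i < 3" for i
  proof -
    have L: "openin X (L i)" "connectedin X (L i)" "p \<in> L i" "e i \<in> L i" using T that by (auto simp: triod_def)
    obtain M where M: "openin X M" "connectedin X M" "q \<in> M" "(f ^^ k) ` M = L i"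
      using lift_open_connected[OF L(1,2) qX, of k] L(3) q(2) by blast
    then obtain a where "a \<in> M" "(f ^^ k) a = e i" using L(4) by (metis imageE)
    then show ?thesis using M by blast
  qed
  then obtain L' e' where L': "\<And>i. i < 3 \<Longrightarrow> openin X (L' i) \<and> connectedin X (L' i) \<and> q \<in> L' i \<and>
      (f ^^ k) ` L' i = L i \<and> e' i \<in> L' i \<and> (f ^^ k) (e' i) = e i"
    by metis
  have LW: "L' i \<subseteq> W" if i: "i < 3" for i
    using cover_maximal[OF W(1), of "L' i"] L'[OF i] q(1) T W(2) i unfolding triod_def by blast
  have G: "openin X {x \<in> topspace X. (f ^^ k) x \<in> G i}" if "i < 3" for i
    by (rule openin_continuous_map_preimage[OF cont_funpow]) (use T that in \<open>auto simp: triod_def\<close>)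
  have eG: "e' i \<in> topspace X \<and> (f ^^ k) (e' i) \<in> G i" if "i < 3" for i
    using L'[OF that] T that openin_subset[of X "L' i"] by (auto simp: triod_def)
  have "openin X (L' i) \<and> connectedin X (L' i) \<and> q \<in> L' i \<and> L' i \<subseteq> W \<and> e' i \<in> L' i \<and>
      openin X {x \<in> topspace X. (f ^^ k) x \<in> G i} \<and> e' i \<in> {x \<in> topspace X. (f ^^ k) x \<in> G i}"
    if i: "i < 3" for i
    using L'[OF i] LW[OF i] G[OF i] eG[OF i] by blast
  moreover have "{x \<in> topspace X. (f ^^ k) x \<in> G i} \<inter> L' j = {}" if "i < 3" "j < 3" "i \<noteq> j" for i j
  proof -
    have "G i \<inter> L j = {}" using T that by (simp add: triod_def)
    then show ?thesis using L'[OF that(2)] by blast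
  qed
  ultimately have "triod X W q L' e' (\<lambda>i. {x \<in> topspace X. (f ^^ k) x \<in> G i})"
    unfolding triod_def by simp
  then show ?thesis using L' by blast
qed

text \<open>Irreducibility yields a point \<open>q\<close> of \<open>U\<close> that some iterate
  sends to the branch point \<open>p\<close>. A triod at \<open>p\<close> inside a sufficiently deep
  cover element lifts to \<open>q\<close>, and expansion keeps the lift in \<open>U\<close>.\<close>

lemma triod_in_each_cover_element:
  assumes p: "p \<in> topspace X" "\<And>V. openin X V \<Longrightarrow> p \<in> V \<Longrightarrow> \<exists>L e G. triod X V p L e G"
    and U: "U \<in> \<U>"
  shows "\<exists>q L e G. triod X U q L e G \<and> q \<in> U"
proof -
  have "openin X U" "U \<noteq> {}" using U0(2)[OF U] by auto
  then obtain m where "(f ^^ m) ` U = topspace X" using irreducible unfolding irreducibility_axiom_def by blast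
  then obtain q where q: "q \<in> U" "(f ^^ m) q = p" using p(1) by (metis imageE)
  obtain N where N: "\<And>n W. \<lbrakk>N < n; W \<in> cover n; q \<in> W\<rbrakk> \<Longrightarrow> W \<subseteq> U"
    using cover_small[OF \<open>openin X U\<close> q(1)] by blast
  obtain V where V: "V \<in> cover (Suc N)" "p \<in> V" using cover_covers[OF p(1)] by blast
  have oV: "openin X V" "connectedin X V" using cover_open_connected[OF V(1)] by auto
  obtain L e G where T: "triod X V p L e G" using p(2)[OF oV(1) V(2)] by blast
  have "q \<in> topspace X" using q \<open>openin X U\<close> openin_subset by blast
  then obtain W where W: "q \<in> W" "(f ^^ m) ` W = V" "W \<in> cover (Suc N + m)"
    using lift_open_connected[OF oV, of q m] q V by blast
  obtain L' e' G' where T': "triod X W q L' e' G'" using lift_triod[OF T W(3,2,1) q(2)] by blast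
  have "W \<subseteq> U" using N[of "Suc N + m" W] W by auto
  then have "triod X U q L' e' G'" using T' unfolding triod_def by blast
  then show ?thesis using q by blast
qed

end

section \<open>Distortion bounds\<close>

lemma finite_uniform_pos:
  fixes P :: "'b \<Rightarrow> real \<Rightarrow> bool"
  assumes "finite A" "\<And>a. a \<in> A \<Longrightarrow> \<exists>c>0. P a c" "\<And>a c c'. \<lbrakk>P a c; 0 < c'; c' \<le> c\<rbrakk> \<Longrightarrow> P a c'"
  shows "\<exists>c>0. \<forall>a\<in>A. P a c"
  using assms(1,2)
proof (induction A rule: finite_induct)
  case empty
  show ?case by (intro exI[of _ 1]) simp
next
  case (insert a A)
  then obtain c where c: "0 < c" "\<forall>a\<in>A. P a c" by blast
  obtain c' where c': "0 < c'" "P a c'" using insert.prems[of a] by blast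
  have "P b (min c c')" if "b \<in> insert a A" for b
  proof (cases "b = a")
    case True
    then show ?thesis using assms(3)[OF c'(2), of "min c c'"] c(1) c'(1) by simp
  next
    case False
    then have "P b c" using that c(2) by simp
    then show ?thesis using assms(3)[of b c "min c c'"] c(1) c'(1) by simp
  qed
  moreover have "0 < min c c'" using c(1) c'(1) by simp
  ultimately show ?case by blast
qed

text \<open>The constant is the preimage of \<open>q\<close> under \<open>\<delta>\<close>; it is
  nonzero since an increasing bijection of the half-line fixes 0. It turns the distortion inequality
  for \<open>\<delta>p\<close> into a lower bound for diameter ratios of lifts.\<close>

lemma diameter_gauge_lower_bound:
  assumes \<delta>: "diameter_gauge \<delta>" and q: "0 < q"
  shows "\<exists>c>0. \<forall>x\<ge>0. q < \<delta> x \<longrightarrow> c \<le> x"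
proof -
  have sm: "strict_mono_on {0..} \<delta>" and "homeomorphic_map (top_of_set {0..}) (top_of_set {0..}) \<delta>"
    using \<delta> by (auto simp: diameter_gauge_def)
  then have im: "\<delta> ` {0..} = {0..}" using homeomorphic_imp_surjective_map by fastforce
  obtain z where z: "0 \<le> z" "\<delta> z = 0" using im by (metis atLeast_iff imageE order_refl)
  have "q \<in> \<delta> ` {0..}" using im q by simp
  then obtain c where c: "0 \<le> c" "\<delta> c = q" by auto
  have "c \<noteq> 0"
  proof
    assume "c = 0"
    then have "\<delta> c \<le> \<delta> z" using strict_mono_onD[OF sm, of 0 z] z(1) by (cases "z = 0") auto
    then show False using c z q by simp
  qed
  moreover have "c \<le> x" if "0 \<le> x" "q < \<delta> x" for x
  proof (rule ccontr)
    assume "\<not> c \<le> x"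
    then have "\<delta> x < \<delta> c" using strict_mono_onD[OF sm, of x c] that c by simp
    then show False using that c by simp
  qed
  ultimately show ?thesis using c by (intro exI[of _ c]) auto
qed

lemma mdiameter_le:
  assumes "S \<noteq> {}" "\<And>x y. \<lbrakk>x \<in> S; y \<in> S\<rbrakk> \<Longrightarrow> mdist d x y \<le> B"
  shows "mdiameter d S \<le> B"
proof -
  have "(SUP (x,y)\<in>S \<times> S. mdist d x y) \<le> B"
    using assms by (intro cSUP_least) auto
  then show ?thesis using assms(1) by (simp add: mdiameter_def)
qed

lemma middle_of_three:
  fixes u :: "nat \<Rightarrow> real"
  shows "\<exists>i j k. i < 3 \<and> j < 3 \<and> k < 3 \<and> j \<noteq> i \<and> k \<noteq> i \<and> u j \<le> u i \<and> u i \<le> u k"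
proof -
  have "u 0 \<le> u 1 \<and> u 1 \<le> u 2 \<or> u 2 \<le> u 1 \<and> u 1 \<le> u 0 \<or> u 1 \<le> u 0 \<and> u 0 \<le> u 2 \<or>
      u 2 \<le> u 0 \<and> u 0 \<le> u 1 \<or> u 0 \<le> u 2 \<and> u 2 \<le> u 1 \<or> u 1 \<le> u 2 \<and> u 2 \<le> u 0"
    by linarith
  moreover have "(0::nat) < 3" "(1::nat) < 3" "(2::nat) < 3" "(0::nat) \<noteq> 1" "(0::nat) \<noteq> 2" "(1::nat) \<noteq> 2"
      "(1::nat) \<noteq> 0" "(2::nat) \<noteq> 0" "(2::nat) \<noteq> 1" by simp_all
  ultimately show ?thesis by meson
qed

section \<open>Diameters, roundness and triods in a metric cxc system\<close>

locale metric_cxc_system = cxc X f \<U> + Metric_space "mspace d" "mdist d"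
  for X :: "'a topology" and f \<U> and d :: "'a metric" +
  fixes \<rho>m \<rho>p \<delta>m \<delta>p
  assumes top: "mtopology = X"
    and \<delta>p: "diameter_gauge \<delta>p"
    and round: "roundness_distortion X f \<U> d \<rho>m \<rho>p"
    and diam: "diameter_distortion X f \<U> d \<delta>m \<delta>p"
begin

lemma topspace_X: "topspace X = mspace d" using top by auto

lemma mbounded_all: "S \<subseteq> mspace d \<Longrightarrow> mbounded S"
proof -
  have "compactin mtopology (mspace d)" using space(1) by (simp add: compact_space_def top topspace_X)
  then show "S \<subseteq> mspace d \<Longrightarrow> mbounded S" using compactin_imp_mbounded mbounded_subset by blast
qed

lemma mdist_le_diam: "\<lbrakk>S \<subseteq> mspace d; x \<in> S; y \<in> S\<rbrakk> \<Longrightarrow> mdist d x y \<le> mdiameter d S"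
  by (rule mdist_le_mdiameter[OF mbounded_all])

lemma mdiameter_nonneg: "S \<subseteq> mspace d \<Longrightarrow> 0 \<le> mdiameter d S"
proof (cases "S = {}")
  case False
  assume S: "S \<subseteq> mspace d"
  from False obtain x where x: "x \<in> S" by blast
  show ?thesis using mdist_le_diam[OF S x x] mdist_nonneg[of d x x] by linarith
qed (simp add: mdiameter_def)

lemma cover_sub: "U \<in> cover n \<Longrightarrow> U \<subseteq> mspace d"
  using cover_open_connected openin_subset topspace_X by metis

text \<open>A cover element with one point would be clopen in a connected space that has at least
  two points.\<close>

lemma mdiameter_cover_pos:
  assumes "U \<in> cover n"
  shows "0 < mdiameter d U"
proof -
  have U: "U \<noteq> {}" "openin X U" "U \<subseteq> mspace d" using cover_open_connected[OF assms] cover_sub[OF assms] by auto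
  then obtain x where x: "x \<in> U" by blast
  have "U \<noteq> {x}"
  proof
    assume "U = {x}"
    then have "openin X {x}" "closedin X {x}"
      using U x space(4) by (auto simp: closedin_Hausdorff_sing_eq topspace_X)
    then have "{x} = topspace X" using space(2) by (auto simp: connected_space_clopen_in)
    then show False using nontrivial by (metis singletonD)
  qed
  then obtain y where y: "y \<in> U" "y \<noteq> x" using x by blast
  then have "0 < mdist d x y" using U(3) x by (metis mdist_pos_less subsetD)
  then show ?thesis using mdist_le_diam[OF U(3) x y(1)] by linarith
qed

text \<open>A ball around \<open>e\<close> inside \<open>W\<close> cannot contain \<open>a\<close>,
  so the inner radius is at most the distance from \<open>e\<close> to \<open>a\<close>. The
  diameter is at most twice the outer radius, which is at most \<open>R\<close> times the inner
  one.\<close>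

lemma mdiameter_le_roundness:
  assumes W: "openin X W" and e: "e \<in> W" and a: "a \<in> mspace d" "a \<notin> W"
    and R: "roundness d W e < R" "0 < R"
  shows "mdiameter d W \<le> 2 * R * mdist d e a"
proof -
  have WM: "W \<subseteq> mspace d" using openin_subset[OF W] topspace_X by simp
  define \<sigma> where "\<sigma> = (SUP x\<in>W. mdist d x e)"
  define A where "A = {r. 0 < r \<and> mball_of d e r \<subseteq> W}"
  have mb: "mball_of d e r = mball e r" for r by (simp add: mball_of_def)
  obtain r where r: "0 < r" "mball e r \<subseteq> W" using W e unfolding top[symmetric] openin_mtopology by blast
  then have rA: "r \<in> A" by (simp add: A_def mb)
  have Aa: "t \<le> mdist d e a" if "t \<in> A" for t
  proof (rule ccontr)
    assume "\<not> t \<le> mdist d e a"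
    then have "a \<in> mball e t" using a(1) e WM by auto
    then show False using that a(2) by (auto simp: A_def mb)
  qed
  then have "bdd_above A" by (intro bdd_aboveI)
  then have "r \<le> Sup A" using rA by (intro cSup_upper)
  then have pos: "0 < Sup A" using r by linarith
  have le: "Sup A \<le> mdist d e a" using rA Aa by (intro cSup_least) auto
  have "bdd_above ((\<lambda>x. mdist d x e) ` W)"
    using mdist_le_diam[OF WM _ e] by (intro bdd_aboveI2)
  then have \<sigma>: "mdist d x e \<le> \<sigma>" if "x \<in> W" for x
    unfolding \<sigma>_def using that by (intro cSUP_upper)
  have "mdiameter d W \<le> 2 * \<sigma>"
  proof (rule mdiameter_le)
    show "W \<noteq> {}" using e by blast
    fix x y assume xy: "x \<in> W" "y \<in> W"
    show "mdist d x y \<le> 2 * \<sigma>"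
      using triangle[of x e y] xy e WM \<sigma>[OF xy(1)] \<sigma>[OF xy(2)] commute[of e y] by (smt (verit) subsetD)
  qed
  also have "\<sigma> / Sup A < R" using R(1) by (simp add: roundness_def \<sigma>_def A_def)
  then have "\<sigma> \<le> R * Sup A" using pos by (simp add: field_simps)
  then have "2 * \<sigma> \<le> 2 * R * mdist d e a" using mult_left_mono[OF le, of R] R(2) by linarith
  finally show ?thesis .
qed

text \<open>The ratio downstairs is one fixed positive number, so diameter distortion bounds the
  ratios of all lifts from below, with a constant independent of \<open>k\<close>.\<close>

lemma diam_ratio_lower_bound:
  assumes V: "V \<in> cover n0" and V1: "V1 \<in> cover n1" "V1 \<subseteq> V"
  shows "\<exists>c>0. \<forall>k. \<forall>W\<in>cover (n0 + k). \<forall>W1\<in>cover (n1 + k). W1 \<subseteq> W \<longrightarrow> (f ^^ k) ` W = V \<longrightarrow>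
      (f ^^ k) ` W1 = V1 \<longrightarrow> c * mdiameter d W \<le> mdiameter d W1"
proof -
  have "0 < mdiameter d V1 / mdiameter d V" using mdiameter_cover_pos V V1 by simp
  then obtain c where c: "0 < c" "\<And>x. \<lbrakk>0 \<le> x; mdiameter d V1 / mdiameter d V < \<delta>p x\<rbrakk> \<Longrightarrow> c \<le> x"
    using diameter_gauge_lower_bound[OF \<delta>p] by blast
  have "c * mdiameter d W \<le> mdiameter d W1"
    if W: "W \<in> cover (n0 + k)" "W1 \<in> cover (n1 + k)" "W1 \<subseteq> W" "(f ^^ k) ` W = V" "(f ^^ k) ` W1 = V1" for k W W1
  proof -
    have "mdiameter d V1 / mdiameter d V < \<delta>p (mdiameter d W1 / mdiameter d W)"
      using diam V V1 W unfolding diameter_distortion_def by blast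
    moreover have "0 \<le> mdiameter d W1 / mdiameter d W" "0 < mdiameter d W"
      using mdiameter_cover_pos[OF W(1)] mdiameter_cover_pos[OF W(2)] by simp_all
    ultimately show ?thesis using c(2)[of "mdiameter d W1 / mdiameter d W"] by (simp add: pos_le_divide_eq)
  qed
  then show ?thesis using c(1) by blast
qed

text \<open>One constant has to serve all lifts of \<open>V\<close> at all levels; separation is
  measured relative to the diameter of the lift.\<close>

definition spread_triods :: "'a set \<Rightarrow> real \<Rightarrow> bool" where
  "spread_triods V c \<longleftrightarrow> (\<forall>n. \<forall>U\<in>cover n. (f ^^ n) ` U = V \<longrightarrow>
     (\<exists>q L e G. triod X U q L e G \<and>
        (\<forall>i<3. \<forall>j<3. i \<noteq> j \<longrightarrow> (\<forall>a\<in>L j. c * mdiameter d U \<le> mdist d (e i) a))))"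

lemma spread_triods_mono:
  assumes "spread_triods V c" "0 < c'" "c' \<le> c"
  shows "spread_triods V c'"
proof -
  have "c' * mdiameter d U \<le> c * mdiameter d U" if "U \<in> cover n" for U n
    using mdiameter_nonneg[OF cover_sub[OF that]] assms(3) by (rule mult_right_mono[rotated])
  then show ?thesis using assms(1) unfolding spread_triods_def by (meson order_trans)
qed

text \<open>All these triods are lifts of a single one. Around an end \<open>e i\<close>, a small
  cover element \<open>V1\<close> is fixed; its lift has diameter comparable to that of
  \<open>U\<close> and bounded roundness, so every point outside the lift is at comparable distance
  from the lifted end. The other lifted legs are outside.\<close>

lemma spread_triods_exist:
  assumes V: "V \<in> \<U>" and T: "triod X V p L e G"
  shows "\<exists>c>0. spread_triods V c"
proof -
  have oV: "openin X V" "connectedin X V" "V \<in> cover 0" using U0(2)[OF V] V by auto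
  let ?Q = "\<lambda>i c. \<forall>n. \<forall>U\<in>cover n. \<forall>a\<in>mspace d. \<forall>y\<in>U. (f ^^ n) ` U = V \<and> (f ^^ n) y = e i \<and>
      (f ^^ n) a \<notin> G i \<longrightarrow> c * mdiameter d U \<le> mdist d y a"
  have "\<exists>c>0. \<forall>i\<in>{..<3}. ?Q i c"
  proof (rule finite_uniform_pos)
    fix i :: nat assume "i \<in> {..<3}"
    then have G: "openin X (G i)" "e i \<in> G i" "e i \<in> V" using T by (auto simp: triod_def)
    \<comment> \<open>\<open>V1\<close> has to lie in \<open>G i\<close> to avoid the other legs,
      and in \<open>V\<close> to have its lifts inside \<open>U\<close> for the diameter
      comparison.\<close>
    then have "openin X (G i \<inter> V)" "e i \<in> G i \<inter> V" using oV by auto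
    from cover_small[OF this]
    obtain N where N: "\<And>n U. \<lbrakk>N < n; U \<in> cover n; e i \<in> U\<rbrakk> \<Longrightarrow> U \<subseteq> G i \<inter> V"
      by blast
    have "e i \<in> topspace X" using G openin_subset by blast
    then obtain V1 where V1: "V1 \<in> cover (Suc N)" "e i \<in> V1" using cover_covers by blast
    have V1s: "V1 \<subseteq> G i" "V1 \<subseteq> V" using N[OF _ V1] by auto
    have oV1: "openin X V1" "connectedin X V1" using cover_open_connected[OF V1(1)] by auto
    from diam_ratio_lower_bound[OF oV(3) V1(1) V1s(2)]
    obtain c where c: "0 < c" and ratio: "\<forall>k. \<forall>W\<in>cover (0 + k). \<forall>W1\<in>cover (Suc N + k). W1 \<subseteq> W \<longrightarrow>
        (f ^^ k) ` W = V \<longrightarrow> (f ^^ k) ` W1 = V1 \<longrightarrow> c * mdiameter d W \<le> mdiameter d W1"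
      by (elim exE conjE) (rule that)
    \<comment> \<open>Roundness distortion bounds the roundness of every lift of \<open>V1\<close>
      by this number; the maximum with 1 makes it positive.\<close>
    define R where "R = max 1 (\<rho>m (roundness d V1 (e i)))"
    have R: "0 < R" by (simp add: R_def)
    have "c / (2 * R) * mdiameter d U \<le> mdist d y a"
      if U: "U \<in> cover n" and a: "a \<in> mspace d" and y: "y \<in> U"
        and f: "(f ^^ n) ` U = V" "(f ^^ n) y = e i" "(f ^^ n) a \<notin> G i" for n U a y
    proof -
      have yX: "y \<in> topspace X" using y cover_sub[OF U] topspace_X by auto
      have "(f ^^ n) y \<in> V1" using f(2) V1(2) by simp
      from lift_open_connected[OF oV1 yX this]
      obtain W1 where W1: "openin X W1" "connectedin X W1" "y \<in> W1" "(f ^^ n) ` W1 = V1"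
        and "\<forall>m. V1 \<in> cover m \<longrightarrow> W1 \<in> cover (m + n)"
        by (elim exE conjE) (rule that)
      then have W1c: "W1 \<in> cover (Suc N + n)" using V1(1) by blast
      have U': "U \<in> cover (0 + n)" using U by simp
      have "W1 \<inter> U \<noteq> {}" using W1(3) y by blast
      moreover have "(f ^^ n) ` W1 \<subseteq> (f ^^ n) ` U" using W1(4) f(1) V1s(2) by simp
      ultimately have "W1 \<subseteq> U" by (rule cover_maximal[OF U' W1(2)])
      then have "c * mdiameter d U \<le> mdiameter d W1"
        using ratio[rule_format, OF U' W1c] f(1) W1(4) by simp
      moreover have "roundness d W1 y < \<rho>m (roundness d V1 (e i))"
        using round[unfolded roundness_distortion_def, rule_format, OF V1(1) W1c W1(3) V1(2)] W1(4) f(2) by simp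
      then have "roundness d W1 y < R" by (simp add: R_def)
      moreover have "a \<notin> W1" using f(3) W1(4) V1s(1) by blast
      ultimately have "c * mdiameter d U \<le> 2 * R * mdist d y a"
        using mdiameter_le_roundness[OF W1(1,3) a] R by fastforce
      then show ?thesis using R by (simp add: field_simps)
    qed
    then show "\<exists>c>0. ?Q i c" using c R by (intro exI[of _ "c / (2 * R)"]) auto
  next
    fix i :: nat and c c' :: real
    assume Q: "?Q i c" and c: "0 < c'" "c' \<le> c"
    have "c' * mdiameter d U \<le> c * mdiameter d U" if "U \<in> cover n" for U n
      using mdiameter_nonneg[OF cover_sub[OF that]] c(2) by (rule mult_right_mono[rotated])
    then show "?Q i c'" using Q by (meson order_trans)
  qed simp
  then obtain c where c: "0 < c" "\<And>i. i < 3 \<Longrightarrow> ?Q i c" by auto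
  have "\<exists>q L e G. triod X U q L e G \<and> (\<forall>i<3. \<forall>j<3. i \<noteq> j \<longrightarrow> (\<forall>a\<in>L j. c * mdiameter d U \<le> mdist d (e i) a))"
    if U: "U \<in> cover n" "(f ^^ n) ` U = V" for n U
  proof -
    have "p \<in> V" using T unfolding triod_def by (metis subsetD zero_less_numeral)
    then obtain q where q: "q \<in> U" "(f ^^ n) q = p" using U(2) by blast
    have U': "U \<in> cover (0 + n)" using U(1) by simp
    obtain L' e' where T': "triod X U q L' e' (\<lambda>i. {x \<in> topspace X. (f ^^ n) x \<in> G i})"
      and L': "\<And>i. i < 3 \<Longrightarrow> (f ^^ n) (e' i) = e i"
      using lift_triod[OF T U' U(2) q] by blast
    have "c * mdiameter d U \<le> mdist d (e' i) a" if "i < 3" "j < 3" "i \<noteq> j" "a \<in> L' j" for i j a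
    proof -
      have "e' i \<in> U" "L' j \<subseteq> U" "{x \<in> topspace X. (f ^^ n) x \<in> G i} \<inter> L' j = {}"
        using T' that unfolding triod_def by blast+
      moreover have "a \<in> mspace d" using \<open>L' j \<subseteq> U\<close> \<open>a \<in> L' j\<close> cover_sub[OF U(1)] by blast
      moreover from calculation have "(f ^^ n) a \<notin> G i" using \<open>a \<in> L' j\<close> topspace_X by blast
      ultimately show ?thesis using c(2)[OF that(1)] U L'[OF that(1)] by blast
    qed
    then show ?thesis using T' by blast
  qed
  then show ?thesis using c(1) unfolding spread_triods_def by blast
qed

text \<open>Starting from a tiny element around \<open>p\<close>, one passes to larger elements at
  coarser levels, \<open>N\<close> levels at a time. Each step changes the diameter by at most the
  factor \<open>1/c\<close>, so stopping just before exceeding \<open>\<rho>\<close> gives the right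
  scale.\<close>

lemma cover_element_at_scale:
  shows "\<exists>c>0. \<exists>r0>0. \<forall>p\<in>mspace d. \<forall>\<rho>. 0 < \<rho> \<and> \<rho> \<le> r0 \<longrightarrow>
    (\<exists>n. \<exists>U\<in>cover n. p \<in> U \<and> c * \<rho> \<le> mdiameter d U \<and> mdiameter d U < \<rho>)"
proof -
  have "\<exists>N. \<forall>n>N. \<forall>U\<in>cover n. \<exists>V\<in>\<U>. U \<subseteq> V"
    using expansion U0 unfolding expansion_axiom_def by blast
  then obtain N0 where "\<And>n U. \<lbrakk>N0 < n; U \<in> cover n\<rbrakk> \<Longrightarrow> \<exists>V\<in>\<U>. U \<subseteq> V" by blast
  then obtain N where N: "0 < N" "\<And>U. U \<in> cover N \<Longrightarrow> \<exists>V\<in>\<U>. U \<subseteq> V" by (metis lessI zero_less_Suc)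
  \<comment> \<open>The comparison is guarded by an inclusion because the constant is minimized over
    the full finite product, whose pairs need not be nested.\<close>
  define P where "P = (\<lambda>a c. snd a \<subseteq> fst a \<longrightarrow> (\<forall>k. \<forall>W\<in>cover (0 + k). \<forall>W1\<in>cover (N + k). W1 \<subseteq> W \<longrightarrow>
      (f ^^ k) ` W = fst a \<longrightarrow> (f ^^ k) ` W1 = snd a \<longrightarrow> c * mdiameter d W \<le> mdiameter d W1))"
  have "\<exists>c>0. \<forall>a\<in>\<U> \<times> cover N. P a c"
  proof (rule finite_uniform_pos)
    show "finite (\<U> \<times> cover N)" using U0(1) finite_cover by simp
  next
    fix a assume "a \<in> \<U> \<times> cover N"
    then have a: "fst a \<in> cover 0" "snd a \<in> cover N" by auto
    show "\<exists>c>0. P a c"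
    proof (cases "snd a \<subseteq> fst a")
      case True
      then show ?thesis using diam_ratio_lower_bound[OF a True] by (simp only: P_def simp_thms)
    next
      case False
      then show ?thesis by (intro exI[of _ 1]) (simp add: P_def)
    qed
  next
    fix a c c' assume P: "P a c" and c: "0 < c'" "c' \<le> c"
    show "P a c'" unfolding P_def
    proof (intro impI allI ballI)
      fix k W W1
      assume W: "snd a \<subseteq> fst a" "W \<in> cover (0 + k)" "W1 \<in> cover (N + k)" "W1 \<subseteq> W"
        "(f ^^ k) ` W = fst a" "(f ^^ k) ` W1 = snd a"
      have "c' * mdiameter d W \<le> c * mdiameter d W"
        using mdiameter_nonneg[OF cover_sub[OF W(2)]] c(2) by (rule mult_right_mono[rotated])
      also have "\<dots> \<le> mdiameter d W1" using P[unfolded P_def, rule_format, OF W] .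
      finally show "c' * mdiameter d W \<le> mdiameter d W1" .
    qed
  qed
  then obtain c where c: "0 < c" and Pc: "\<forall>a\<in>\<U> \<times> cover N. P a c" by (elim exE conjE) (rule that)
  have ratio: "c * mdiameter d W \<le> mdiameter d W1"
    if "V \<in> \<U>" "V1 \<in> cover N" "V1 \<subseteq> V" "W \<in> cover (0 + k)" "W1 \<in> cover (N + k)"
      "W1 \<subseteq> W" "(f ^^ k) ` W = V" "(f ^^ k) ` W1 = V1" for V V1 k W W1
  proof -
    have "P (V, V1) c" using Pc that(1,2) by simp
    from this[unfolded P_def fst_conv snd_conv, rule_format, OF that(3-8)] show ?thesis .
  qed
  \<comment> \<open>Below this radius the climb stops before level 0, whose elements are all too
    large.\<close>
  have "\<exists>r0>0. \<forall>U\<in>\<U>. r0 \<le> mdiameter d U"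
    using finite_uniform_pos[OF U0(1), of "\<lambda>U r. r \<le> mdiameter d U"] mdiameter_cover_pos[of _ 0] by force
  then obtain r0 where r0: "0 < r0" "\<And>U. U \<in> \<U> \<Longrightarrow> r0 \<le> mdiameter d U" by blast
  have descend: "\<exists>n. \<exists>U\<in>cover n. p \<in> U \<and> c * \<rho> \<le> mdiameter d U \<and> mdiameter d U < \<rho>"
    if "U \<in> cover (N * i)" "p \<in> U" "mdiameter d U < \<rho>" "0 < \<rho>" "\<rho> \<le> r0" for U p \<rho> i
    using that
  proof (induction i arbitrary: U)
    case 0
    then show ?case using r0(2)[of U] by simp
  next
    case (Suc i)
    let ?k = "N * i"
    have U: "U \<in> cover (N + ?k)" using Suc.prems(1) by simp
    let ?V1 = "(f ^^ ?k) ` U"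
    have V1: "?V1 \<in> cover N" using cover_image[OF U] .
    then obtain V where V: "V \<in> \<U>" "?V1 \<subseteq> V" using N(2) by blast
    have pX: "p \<in> topspace X" using Suc.prems(2) cover_sub[OF U] topspace_X by blast
    have "(f ^^ ?k) p \<in> V" using V Suc.prems(2) by blast
    moreover have "openin X V" "connectedin X V" using U0(2)[OF V(1)] by auto
    moreover have "V \<in> cover 0" using V by simp
    ultimately obtain W where W: "p \<in> W" "(f ^^ ?k) ` W = V" "W \<in> cover (0 + ?k)"
      using lift_open_connected[OF _ _ pX, of V ?k] by blast
    have "connectedin X U" using cover_open_connected[OF U] by blast
    then have "U \<subseteq> W" using cover_maximal[OF W(3), of U] Suc.prems(2) W(1,2) V(2) by blast
    have W': "W \<in> cover ?k" using W(3) by simp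
    have "c * mdiameter d W \<le> mdiameter d U"
      by (rule ratio[OF V(1) V1 V(2) W(3) U \<open>U \<subseteq> W\<close> W(2) refl])
    show ?case
    proof (cases "mdiameter d W < \<rho>")
      case True
      then show ?thesis using Suc.IH[OF W' W(1)] Suc.prems by blast
    next
      \<comment> \<open>The next larger element \<open>W\<close> is already too big, so
        \<open>U\<close>, which is comparable to it, has the wanted size.\<close>
      case False
      then have "c * \<rho> \<le> c * mdiameter d W" using c by simp
      then have "c * \<rho> \<le> mdiameter d U" using \<open>c * mdiameter d W \<le> mdiameter d U\<close> by linarith
      then show ?thesis using U Suc.prems by blast
    qed
  qed
  have "\<exists>n. \<exists>U\<in>cover n. p \<in> U \<and> c * \<rho> \<le> mdiameter d U \<and> mdiameter d U < \<rho>"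
    if p: "p \<in> mspace d" and \<rho>: "0 < \<rho>" "\<rho> \<le> r0" for p \<rho>
  proof -
    have "openin X (mball p (\<rho> / 3))" "p \<in> mball p (\<rho> / 3)" using p \<rho> by (auto simp flip: top)
    from cover_small[OF this]
    obtain m where m: "\<And>n U. \<lbrakk>m < n; U \<in> cover n; p \<in> U\<rbrakk> \<Longrightarrow> U \<subseteq> mball p (\<rho> / 3)"
      by blast
    \<comment> \<open>The starting level must be a multiple of \<open>N\<close> so that the climb in
      steps of \<open>N\<close> ends at level 0.\<close>
    have "m < N * Suc m" using N(1) by (cases N) auto
    moreover obtain U where U: "U \<in> cover (N * Suc m)" "p \<in> U" using cover_covers[of p] p topspace_X by metis
    ultimately have Ub: "U \<subseteq> mball p (\<rho> / 3)" using m by blast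
    have "mdiameter d U \<le> 2 * \<rho> / 3"
    proof (rule mdiameter_le)
      fix x y assume "x \<in> U" "y \<in> U"
      then have "x \<in> mball p (\<rho> / 3)" "y \<in> mball p (\<rho> / 3)" using Ub by auto
      then show "mdist d x y \<le> 2 * \<rho> / 3" using triangle[of x p y] commute[of x p] by auto
    qed (use U in blast)
    then have "mdiameter d U < \<rho>" using \<rho> by simp
    then show ?thesis using descend[OF U(1,2)] \<rho> by blast
  qed
  then show ?thesis using c r0(1) by blast
qed

text \<open>The separation constant is the product of the spread constant of the triods, relative to
  a cover element, and the ratio of that element's diameter to \<open>\<rho>\<close>.\<close>

lemma forked_if_tripod:
  assumes "S \<subseteq> topspace X" "subtopology X S homeomorphic_space top_of_set tripod"
  shows "\<exists>c>0. \<exists>r0>0. forked c r0"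
proof -
  from local_triods_if_tripod[OF space(1,4,3) assms]
  obtain p0 where p0: "p0 \<in> topspace X" and triods: "\<forall>V. openin X V \<and> p0 \<in> V \<longrightarrow> (\<exists>L e G. triod X V p0 L e G)"
    by (elim bexE) (rule that)
  have "\<exists>c>0. \<forall>V\<in>\<U>. spread_triods V c"
  proof (rule finite_uniform_pos[OF U0(1)])
    fix V assume V: "V \<in> \<U>"
    show "\<exists>c>0. spread_triods V c"
      using triod_in_each_cover_element[OF p0 triods[rule_format] V] spread_triods_exist[OF V] by blast
  qed (rule spread_triods_mono)
  then obtain c1 where c1: "0 < c1" "\<And>V. V \<in> \<U> \<Longrightarrow> spread_triods V c1" by blast
  from cover_element_at_scale
  obtain c2 r0 where c2: "0 < c2" "0 < r0" and scale: "\<And>p \<rho>. \<lbrakk>p \<in> mspace d; 0 < \<rho>; \<rho> \<le> r0\<rbrakk> \<Longrightarrow>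
      \<exists>n. \<exists>U\<in>cover n. p \<in> U \<and> c2 * \<rho> \<le> mdiameter d U \<and> mdiameter d U < \<rho>"
    by blast
  have "forked (c1 * c2) r0"
    unfolding forked_def
  proof (intro ballI allI impI)
    fix p \<rho> x0 assume p: "p \<in> mspace d" "x0 \<in> mspace d" and \<rho>: "0 < \<rho> \<and> \<rho> \<le> r0"
    obtain n U where U: "U \<in> cover n" "p \<in> U" "c2 * \<rho> \<le> mdiameter d U" "mdiameter d U < \<rho>"
      using scale[OF p(1)] \<rho> by blast
    have UM: "U \<subseteq> mspace d" by (rule cover_sub[OF U(1)])
    have Ub: "U \<subseteq> mball p \<rho>" using mdist_le_diam[OF UM U(2)] U(4) UM p(1) by force
    have "(f ^^ n) ` U \<in> \<U>" using cover_image[of U 0 n] U(1) by simp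
    from c1(2)[OF this, unfolded spread_triods_def, rule_format, OF U(1) refl]
    obtain q L e G where T: "triod X U q L e G"
      and far: "\<forall>i<3. \<forall>j<3. i \<noteq> j \<longrightarrow> (\<forall>a\<in>L j. c1 * mdiameter d U \<le> mdist d (e i) a)"
      by (elim exE conjE) (rule that)
    obtain i j k where ijk: "i < 3" "j < 3" "k < 3" "j \<noteq> i" "k \<noteq> i"
      "mdist d x0 (e j) \<le> mdist d x0 (e i)" "mdist d x0 (e i) \<le> mdist d x0 (e k)"
      using middle_of_three[of "\<lambda>i. mdist d x0 (e i)"] by blast
    have Lj: "connectedin X (L j)" "connectedin X (L k)" "q \<in> L j" "q \<in> L k" "L j \<subseteq> U" "L k \<subseteq> U"
      "e j \<in> L j" "e k \<in> L k" and ei: "e i \<in> U"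
      using T ijk(1,2,3) unfolding triod_def by blast+
    \<comment> \<open>Both legs contain the centre \<open>q\<close>; by the intermediate value
      theorem their union attains the distance of the middle end \<open>e i\<close> from
      \<open>x0\<close>, at a point far from \<open>e i\<close>.\<close>
    have "connectedin X (L j \<union> L k)" using Lj by (intro connectedin_Un) auto
    then have "connected (mdist d x0 ` (L j \<union> L k))"
      using connectedin_continuous_map_image[OF continuous_map_dist[OF p(2)]] top by fastforce
    then have "mdist d x0 (e i) \<in> mdist d x0 ` (L j \<union> L k)"
      using ijk(6,7) Lj(7,8) unfolding connected_iff_interval by blast
    then obtain b where b: "b \<in> L j \<union> L k" "mdist d x0 (e i) = mdist d x0 b" by blast
    have "c1 * mdiameter d U \<le> mdist d (e i) b" using b(1) far ijk(1-5) by blast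
    moreover have "c1 * c2 * \<rho> \<le> c1 * mdiameter d U" using U(3) c1(1) by simp
    ultimately have "c1 * c2 * \<rho> \<le> mdist d (e i) b" by linarith
    moreover have "e i \<in> mball p \<rho>" "b \<in> mball p \<rho>" using ei b(1) Lj(5,6) Ub by blast+
    ultimately show "\<exists>e\<in>mball p \<rho>. \<exists>q\<in>mball p \<rho>. mdist d x0 e = mdist d x0 q \<and> c1 * c2 * \<rho> \<le> mdist d e q"
      using b(2) by blast
  qed
  then show ?thesis using c1(1) c2 by (meson mult_pos_pos)
qed

end

theorem theorem1:
  fixes X :: "'a topology" and f :: "'a \<Rightarrow> 'a"
  assumes "compact_space X" and "connected_space X" and "locally_connected_space X"
    and "metrizable_space X"
    and "topological_cxc X f"
    and "\<exists>S. S \<subseteq> topspace X \<and> subtopology X S homeomorphic_space top_of_set tripod"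
  shows "\<forall>d\<in>canonical_gauge X f. hausdorff_dimension d > 1"
proof
  fix d assume "d \<in> canonical_gauge X f"
  then obtain \<U> \<rho>m \<rho>p \<delta>m \<delta>p where d: "mtopology_of d = X" "topological_cxc_wrt X f \<U>"
      "diameter_gauge \<delta>p" "roundness_distortion X f \<U> d \<rho>m \<rho>p" "diameter_distortion X f \<U> d \<delta>m \<delta>p"
    unfolding canonical_gauge_def metric_cxc_def by blast
  interpret Metric_space "mspace d" "mdist d" by simp
  interpret metric_cxc_system X f \<U> d \<rho>m \<rho>p \<delta>m \<delta>p
    by unfold_locales (use d in \<open>simp_all add: mtopology_of_def\<close>)
  obtain c r0 where "0 < c" "0 < r0" "forked c r0" using forked_if_tripod assms(6) by blast
  moreover obtain x y where "x \<in> mspace d" "y \<in> mspace d" "x \<noteq> y" using nontrivial topspace_X by blast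
  ultimately show "hausdorff_dimension d > 1"
    using hausdorff_dimension_gt_1[of d x y c r0] assms(1,2) d(1) by simp
qed

end
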